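(* Let $m\ge 1$ be an integer, let $r\in\mathbb{Z}$, and suppose that the symbol $w$ and $r$ are such that $D^{(r)}_n\neq 0$ for $n\in\{2m,2m-1,2m-2\}$ and also $D^{(r-2)}_{2m-1}\neq 0$. Define $$\boldsymbol{Y}_{m}(z;r):=\boldsymbol{A}_m(r)^{-1}\begin{pmatrix} P_{2m}(z;r) & \mathscr{D}_{2m}(z;r) & z^4G_{2m}(z;r)\\ P_{2m-1}(z;r) & \mathscr{D}_{2m-1}(z;r) & z^2G_{2m-1}(z;r)\\ P_{2m-2}(z;r) & \mathscr{D}_{2m-2}(z;r) & G_{2m-2}(z;r)\end{pmatrix},\qquad \boldsymbol{A}_{m}(r)=\begin{pmatrix}1 & p^{(r)}_{2m,1} & \mathfrak{g}^{(r)}_{2m}\\ 0&1&\mathfrak{g}^{(r)}_{2m-1}\\ 0&0&\mathfrak{g}^{(r)}_{2m-2}\end{pmatrix}.$$ Then $\boldsymbol{Y}_m(z;r)$ is uniquely well-defined by this formula and satisfies the following Riemann-Hilbert problem. (Y1) The matrix-valued function $\boldsymbol{Y}_m(\cdot;r):\mathbb{C}\setminus\mathbb{T}\to\mathbb{C}^{3\times3}$ is holomorphic. (Y2) On the unit circle, $$\boldsymbol{Y}_{m,+}(z;r)=\boldsymbol{Y}_{m,-}(z;r)\begin{pmatrix}1&0&j_1(z;m,r)\\0&1&j_2(z;m,r)\\0&0&1\end{pmatrix},\qquad z\in\mathbb{T},$$ where $j_1(z;m,r)=z^{-4m-r+4}\left[w(z)+(-1)^r w(-z)\right]$ and $j_2(z;m,r)=2(-1)^{r+1}z^{-4m-r+5}w(-z)$.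 (Y3) As $z\to\infty$, $$\boldsymbol{Y}_m(z;r)=\left(I+\frac{\overset{\infty}{\boldsymbol{Y}}_1(m,r)}{z}+\frac{\overset{\infty}{\boldsymbol{Y}}_2(m,r)}{z^2}+O(z^{-3})\right)\begin{pmatrix}z^{2m}&0&0\\0&z^{2m-2}&0\\0&0&z^{-4m+2}\end{pmatrix},$$ where $$\overset{\infty}{\boldsymbol{Y}}_1(m,r)=\begin{pmatrix}0&0&0\\1&0&0\\0&0&0\end{pmatrix}\qquad\text{and}\qquad \overset{\infty}{\boldsymbol{Y}}_{2,31}(m,r)\neq 0,$$ the latter being the $(3,1)$ entry of $\overset{\infty}{\boldsymbol{Y}}_2(m,r)$.
   Context: $\mathbb{T}$ is the unit circle, oriented counterclockwise; the subscripts $+$ and $-$ denote boundary values on $\mathbb{T}$ from the inside and the outside respectively. $w$ is a weight function (symbol) on $\mathbb{T}$, regular enough that the Plemelj–Sokhotskii formula holds (with continuous boundary values) for Cauchy transforms over $\mathbb{T}$ of $w$ times Laurent polynomials. Its moments are $w_\ell=\int_{\mathbb{T}} w(\zeta)\zeta^{-\ell}\frac{d\zeta}{2\pi \mathrm{i}\zeta}$, $\ell\in\mathbb{Z}$. For $t\in\mathbb{Z}$, $D^{(t)}_n:=\det(w_{2j-k+t})_{0\le j,k\le n-1}$, with $D^{(t)}_0:=1$. When $D^{(r)}_n\ne0$, $P_n(z;r)$ is the unique monic polynomial of degree $n$ with $\int_{\mathbb{T}}P_n(\zeta;r)\zeta^{-2k-r}w(\zeta)\frac{d\zeta}{2\pi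 \mathrm{i}\zeta}=0$ for $k=0,\dots,n-1$; it is given by $1/D_n^{(r)}$ times the determinant of the $(n+1)\times(n+1)$ matrix whose row $j$, $0\le j\le n-1$, is $(w_{r+2j},w_{r+2j-1},\dots,w_{r+2j-n})$ and whose last row is $(1,z,\dots,z^n)$. Write $P_n(z;r)=z^n+\sum_{\ell=1}^n p^{(r)}_{n,\ell}z^{n-\ell}$. Further, $$G_n(z;r):=2z^{-2n}\int_{\mathbb{T}}P_n(\zeta;r)w(\zeta)\zeta^{-r}\frac{\zeta^2}{\zeta^2-z^2}\frac{d\zeta}{2\pi \mathrm{i}\zeta},\qquad \mathscr{D}_k(z;r):=\frac{1}{2z}\big(P_k(z;r)-P_k(-z;r)\big),\qquad \mathfrak{g}^{(r)}_n:=-2(-1)^n\frac{D^{(r-2)}_{n+1}}{D^{(r)}_n}.$$ *)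

theory Defs
  imports
    "Jordan_Normal_Form.Determinant"
    "HOL-Complex_Analysis.Complex_Analysis"
    "HOL-Library.Landau_Symbols"
begin

no_notation Matrix.vec_index (infixl \<open>$\<close> 100)

abbreviation unit_circle :: "complex set" where
  "unit_circle \<equiv> sphere 0 1"

text \<open>The integral of \<open>f\<close> over the counterclockwise unit circle with respect to
  \<open>d\<zeta> / (2 \<pi> \<i> \<zeta>)\<close>.\<close>

definition circle_int :: "(complex \<Rightarrow> complex) \<Rightarrow> complex" where
  "circle_int f = contour_integral (circlepath 0 1) (\<lambda>\<zeta>. f \<zeta> / (2 * of_real pi * \<i> * \<zeta>))"

text \<open>Boundary values are limits over the full inner, respectively outer, side of the circle.\<close>

definition has_boundary_values ::
    "(complex \<Rightarrow> 'a::topological_space) \<Rightarrow> (complex \<Rightarrow> 'a) \<Rightarrow> (complex \<Rightarrow> 'a) \<Rightarrow> bool" where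
  "has_boundary_values F Fp Fm \<longleftrightarrow>
     continuous_on unit_circle Fp \<and> continuous_on unit_circle Fm \<and>
     (\<forall>z\<in>unit_circle. (F \<longlongrightarrow> Fp z) (at z within ball 0 1) \<and>
                      (F \<longlongrightarrow> Fm z) (at z within - cball 0 1))"

definition cauchy_transform :: "(complex \<Rightarrow> complex) \<Rightarrow> complex \<Rightarrow> complex" where
  "cauchy_transform f z =
     contour_integral (circlepath 0 1) (\<lambda>\<zeta>. f \<zeta> / (\<zeta> - z)) / (2 * of_real pi * \<i>)"

definition plemelj_sokhotskii :: "(complex \<Rightarrow> complex) \<Rightarrow> bool" where
  "plemelj_sokhotskii f \<longleftrightarrow>
     (\<exists>Fp Fm. has_boundary_values (cauchy_transform f) Fp Fm \<and>
              (\<forall>z\<in>unit_circle. Fp z - Fm z = f z))"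

text \<open>Laurent polynomials are written as \<open>\<zeta> powi k * poly q \<zeta>\<close>.
  The Laurent polynomial \<open>1\<close> already forces \<open>w\<close> to be continuous on the circle, so all
  integrals below exist.\<close>

definition regular_symbol :: "(complex \<Rightarrow> complex) \<Rightarrow> bool" where
  "regular_symbol w \<longleftrightarrow>
     (\<forall>(k::int) (q::complex poly). plemelj_sokhotskii (\<lambda>\<zeta>. w \<zeta> * (\<zeta> powi k * poly q \<zeta>)))"

definition moment :: "(complex \<Rightarrow> complex) \<Rightarrow> int \<Rightarrow> complex" where
  "moment w l = circle_int (\<lambda>\<zeta>. w \<zeta> * \<zeta> powi (- l))"

definition Ddet :: "(complex \<Rightarrow> complex) \<Rightarrow> int \<Rightarrow> nat \<Rightarrow> complex" where
  "Ddet w t n = Determinant.det (Matrix.mat n n (\<lambda>(j, k). moment w (2 * int j - int k + t)))"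

lemma Ddet_0: "Ddet w t 0 = 1"
  by (simp add: Ddet_def)

definition is_monic_orthogonal ::
    "(complex \<Rightarrow> complex) \<Rightarrow> int \<Rightarrow> nat \<Rightarrow> complex poly \<Rightarrow> bool" where
  "is_monic_orthogonal w r n p \<longleftrightarrow>
     degree p = n \<and> lead_coeff p = 1 \<and>
     (\<forall>k<n. circle_int (\<lambda>\<zeta>. poly p \<zeta> * \<zeta> powi (- 2 * int k - r) * w \<zeta>) = 0)"

text \<open>Meaningful when \<open>Ddet w r n \<noteq> 0\<close>.\<close>

definition Ppoly :: "(complex \<Rightarrow> complex) \<Rightarrow> int \<Rightarrow> nat \<Rightarrow> complex poly" where
  "Ppoly w r n = (THE p. is_monic_orthogonal w r n p)"

definition pcoeff :: "(complex \<Rightarrow> complex) \<Rightarrow> int \<Rightarrow> nat \<Rightarrow> nat \<Rightarrow> complex" where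
  "pcoeff w r n l = coeff (Ppoly w r n) (n - l)"

definition Gfun :: "(complex \<Rightarrow> complex) \<Rightarrow> int \<Rightarrow> nat \<Rightarrow> complex \<Rightarrow> complex" where
  "Gfun w r n z = 2 * z powi (- 2 * int n) *
     circle_int (\<lambda>\<zeta>. poly (Ppoly w r n) \<zeta> * w \<zeta> * \<zeta> powi (- r) * (\<zeta>^2 / (\<zeta>^2 - z^2)))"

definition Dfun :: "(complex \<Rightarrow> complex) \<Rightarrow> int \<Rightarrow> nat \<Rightarrow> complex \<Rightarrow> complex" where
  "Dfun w r k z = 1 / (2 * z) * (poly (Ppoly w r k) z - poly (Ppoly w r k) (- z))"

definition gcoeff :: "(complex \<Rightarrow> complex) \<Rightarrow> int \<Rightarrow> nat \<Rightarrow> complex" where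
  "gcoeff w r n = - 2 * (- 1) ^ n * (Ddet w (r - 2) (n + 1) / Ddet w r n)"

definition Amat :: "(complex \<Rightarrow> complex) \<Rightarrow> int \<Rightarrow> nat \<Rightarrow> complex^3^3" where
  "Amat w r m = vector [
     vector [1, pcoeff w r (2 * m) 1, gcoeff w r (2 * m)],
     vector [0, 1,                    gcoeff w r (2 * m - 1)],
     vector [0, 0,                    gcoeff w r (2 * m - 2)]]"

text \<open>The entries \<open>Dfun\<close> and \<open>Gfun\<close> divide by powers of \<open>z\<close>, so the formula proper makes sense
  only for \<open>z \<noteq> 0\<close>. The origin is a removable singularity, and \<open>Ymat\<close> takes the limit there.\<close>

definition Yformula :: "(complex \<Rightarrow> complex) \<Rightarrow> int \<Rightarrow> nat \<Rightarrow> complex \<Rightarrow> complex^3^3" where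
  "Yformula w r m z = matrix_inv (Amat w r m) ** vector [
     vector [poly (Ppoly w r (2 * m)) z,     Dfun w r (2 * m) z,     z^4 * Gfun w r (2 * m) z],
     vector [poly (Ppoly w r (2 * m - 1)) z, Dfun w r (2 * m - 1) z, z^2 * Gfun w r (2 * m - 1) z],
     vector [poly (Ppoly w r (2 * m - 2)) z, Dfun w r (2 * m - 2) z, Gfun w r (2 * m - 2) z]]"

definition Ymat :: "(complex \<Rightarrow> complex) \<Rightarrow> int \<Rightarrow> nat \<Rightarrow> complex \<Rightarrow> complex^3^3" where
  "Ymat w r m z = (if z = 0 then Lim (at 0) (Yformula w r m) else Yformula w r m z)"

definition jump1 :: "(complex \<Rightarrow> complex) \<Rightarrow> int \<Rightarrow> nat \<Rightarrow> complex \<Rightarrow> complex" where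
  "jump1 w r m z = z powi (- 4 * int m - r + 4) * (w z + (- 1) powi r * w (- z))"

definition jump2 :: "(complex \<Rightarrow> complex) \<Rightarrow> int \<Rightarrow> nat \<Rightarrow> complex \<Rightarrow> complex" where
  "jump2 w r m z = 2 * (- 1) powi (r + 1) * z powi (- 4 * int m - r + 5) * w (- z)"

end

theory Submission
  imports Defs
begin

text \<open>Write \<open>f\<^sub>n \<zeta> = w \<zeta> * \<zeta> powi (- r) * P\<^sub>n \<zeta>\<close>. Everything rests on the even part of the Cauchy transform,
  \<open>S f z = \<integral> f \<zeta> * \<zeta>\<^sup>2 / (\<zeta>\<^sup>2 - z\<^sup>2)\<close> (against \<open>d\<zeta> / (2 \<pi> \<i> \<zeta>)\<close>), for which
  \<open>2 * S f z = C f z + C f (- z)\<close> with \<open>C\<close> the Cauchy transform, and \<open>G\<^sub>n z = 2 * z powi (- 2 * n) * S f\<^sub>n z\<close>.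

  The powers of \<open>z\<close> in the three rows are chosen so that each entry of the third column of the
  unnormalised matrix is \<open>z powi (4 - 4 * m) * (C f\<^sub>n z + C f\<^sub>n (- z))\<close>, with the same exponent in
  every row. By the Plemelj-Sokhotskii formula it jumps by
  \<open>z powi (4 - 4 * m) * (f\<^sub>n z + f\<^sub>n (- z))\<close>. Since \<open>P\<^sub>n (- z) = P\<^sub>n z - 2 * z * D\<^sub>n z\<close>, this is a combination
  of the first two entries of the row, whose coefficients \<open>j\<^sub>1\<close> and \<open>j\<^sub>2\<close> do not depend on the row. That is
  the jump relation (lemma \<open>Yraw_boundary_values\<close>), and it survives multiplication by a
  constant matrix from the left.

  Both ends of the sphere are governed by the recursion
  \<open>S f z = \<integral> f + z\<^sup>2 * S (\<zeta> powi (- 2) * f) z\<close>. Run towards the origin, orthogonality kills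
  the first \<open>n\<close> integrals, so that \<open>S f\<^sub>n\<close> vanishes there to order \<open>2 * n\<close>, and the singular factor of
  \<open>G\<^sub>n\<close> cancels. Run towards infinity, it yields \<open>G\<^sub>n z = z powi (- 2 * n - 2) * (g\<^sub>n + O(z powi (- 2)))\<close>, where the
  leading coefficient is minus twice the first moment of \<open>P\<^sub>n\<close> beyond the orthogonality relations; Cramer's rule turns it
  into the quotient of determinants \<open>g\<^sub>n\<close> (lemma \<open>first_moment_Ppoly\<close>).

  After the growth of the columns is divided out, the unnormalised matrix therefore has an expansion
  \<open>A + B\<^sub>1 / z + B\<^sub>2 / z\<^sup>2 + O(z powi (- 3))\<close> (lemma \<open>Yraw_expansion\<close>) whose leading
  coefficient is precisely the normalising matrix \<open>A\<close>. The first column of \<open>B\<^sub>1\<close> is the second column of \<open>A\<close> and the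
  rest is zero, so that \<open>A\<close> maps the claimed coefficient of \<open>1 / z\<close> to \<open>B\<^sub>1\<close>. The \<open>(3,1)\<close> entry of
  \<open>B\<^sub>2\<close> is \<open>1\<close>, because \<open>P\<^bsub>2m-2\<^esub>\<close> is monic, and the last row of \<open>A\<close> is \<open>(0, 0, g\<^bsub>2m-2\<^esub>)\<close>; so the
  \<open>(3,1)\<close> entry of the normalised second coefficient is \<open>1 / g\<^bsub>2m-2\<^esub>\<close>.\<close>

text \<open>Without this, every matrix index below could also be read as a power series coefficient.\<close>

no_notation Formal_Power_Series.fps_nth (infixl \<open>$\<close> 75)

section \<open>Normalised integrals over the unit circle\<close>

lemma circle_int_cong:
  assumes "\<And>\<zeta>. \<zeta> \<in> unit_circle \<Longrightarrow> f \<zeta> = g \<zeta>"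
  shows "circle_int f = circle_int g"
  unfolding circle_int_def
  by (rule contour_integral_cong) (use assms in auto)

lemma circle_integrable:
  assumes "continuous_on unit_circle f"
  shows "(\<lambda>\<zeta>. f \<zeta> / (2 * of_real pi * \<i> * \<zeta>)) contour_integrable_on circlepath 0 1"
  by (rule contour_integrable_continuous_circlepath)
    (use assms in \<open>auto intro!: continuous_intros\<close>)

lemma circle_int_add:
  assumes "continuous_on unit_circle f" "continuous_on unit_circle g"
  shows "circle_int (\<lambda>\<zeta>. f \<zeta> + g \<zeta>) = circle_int f + circle_int g"
  unfolding circle_int_def
  by (simp add: add_divide_distrib contour_integral_add circle_integrable assms)

lemma circle_int_cmult:
  assumes "continuous_on unit_circle f"
  shows "circle_int (\<lambda>\<zeta>. c * f \<zeta>) = c * circle_int f"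
proof -
  have "circle_int (\<lambda>\<zeta>. c * f \<zeta>)
      = contour_integral (circlepath 0 1) (\<lambda>\<zeta>. c * (f \<zeta> / (2 * of_real pi * \<i> * \<zeta>)))"
    unfolding circle_int_def by simp
  also have "\<dots> = c * circle_int f"
    unfolding circle_int_def by (rule contour_integral_lmul) (rule circle_integrable [OF assms])
  finally show ?thesis .
qed

lemma circle_int_sum:
  assumes "finite I" "\<And>k. k \<in> I \<Longrightarrow> continuous_on unit_circle (f k)"
  shows "circle_int (\<lambda>\<zeta>. \<Sum>k\<in>I. f k \<zeta>) = (\<Sum>k\<in>I. circle_int (f k))"
  unfolding circle_int_def sum_divide_distrib
  by (rule contour_integral_sum) (use assms circle_integrable in auto)

text \<open>The measure \<open>d\<zeta> / (2 \<pi> \<i> \<zeta>)\<close> has total mass one on the circle.\<close>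

lemma norm_circle_int_le:
  assumes "continuous_on unit_circle f" "B \<ge> 0" "\<And>\<zeta>. \<zeta> \<in> unit_circle \<Longrightarrow> norm (f \<zeta>) \<le> B"
  shows "norm (circle_int f) \<le> B"
proof -
  have "norm (circle_int f) \<le> B / (2 * pi) * (2 * pi * 1)"
    unfolding circle_int_def
  proof (rule has_contour_integral_bound_circlepath)
    show "((\<lambda>\<zeta>. f \<zeta> / (2 * of_real pi * \<i> * \<zeta>)) has_contour_integral
            contour_integral (circlepath 0 1) (\<lambda>\<zeta>. f \<zeta> / (2 * of_real pi * \<i> * \<zeta>))) (circlepath 0 1)"
      by (rule has_contour_integral_integral) (rule circle_integrable [OF assms(1)])
    fix x :: complex assume "norm (x - 0) = 1"
    with assms(3) [of x] show "norm (f x / (2 * of_real pi * \<i> * x)) \<le> B / (2 * pi)"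
      by (simp add: norm_divide norm_mult divide_right_mono)
  qed (use assms in auto)
  then show ?thesis by simp
qed

lemma continuous_on_circle_powi [continuous_intros]:
  "continuous_on unit_circle (\<lambda>\<zeta>::complex. \<zeta> powi k)"
  by (intro continuous_intros) auto

section \<open>The Cauchy transform and its even part\<close>

text \<open>Up to the factor \<open>2 * z powi (- 2 * n)\<close>, this is the integral in the function \<open>Gfun\<close>.\<close>

definition even_cauchy :: "(complex \<Rightarrow> complex) \<Rightarrow> complex \<Rightarrow> complex" where
  "even_cauchy f z = circle_int (\<lambda>\<zeta>. f \<zeta> * (\<zeta>\<^sup>2 / (\<zeta>\<^sup>2 - z\<^sup>2)))"

lemma circle_square_ne:
  assumes "norm z \<noteq> 1" "\<zeta> \<in> unit_circle"
  shows "\<zeta>\<^sup>2 - z\<^sup>2 \<noteq> (0::complex)"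
  using assms by (auto simp: power2_eq_iff)

lemma continuous_on_even_kernel:
  assumes "continuous_on unit_circle f" "norm z \<noteq> 1"
  shows "continuous_on unit_circle (\<lambda>\<zeta>. f \<zeta> * (\<zeta>\<^sup>2 / (\<zeta>\<^sup>2 - z\<^sup>2)))"
  by (intro continuous_intros assms) (use circle_square_ne [OF assms(2)] in auto)

lemma cauchy_transform_circle_int:
  assumes "continuous_on unit_circle f" "norm z \<noteq> 1"
  shows "cauchy_transform f z = circle_int (\<lambda>\<zeta>. f \<zeta> * (\<zeta> / (\<zeta> - z)))"
proof -
  have "(\<lambda>\<zeta>. f \<zeta> / (\<zeta> - z)) contour_integrable_on circlepath 0 1"
    by (rule contour_integrable_continuous_circlepath)
      (use assms in \<open>auto intro!: continuous_intros\<close>)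
  then have "cauchy_transform f z
      = contour_integral (circlepath 0 1) (\<lambda>\<zeta>. f \<zeta> / (\<zeta> - z) / (2 * of_real pi * \<i>))"
    unfolding cauchy_transform_def by (rule contour_integral_div [symmetric])
  also have "\<dots> = circle_int (\<lambda>\<zeta>. f \<zeta> * (\<zeta> / (\<zeta> - z)))"
    unfolding circle_int_def
    by (rule contour_integral_cong) (auto simp: divide_simps)
  finally show ?thesis .
qed

text \<open>Partial fractions: \<open>2 * \<zeta>\<^sup>2 / (\<zeta>\<^sup>2 - z\<^sup>2) = \<zeta> / (\<zeta> - z) + \<zeta> / (\<zeta> + z)\<close>. This carries holomorphy and
  boundary values from the Cauchy transform over to \<open>even_cauchy\<close>.\<close>

lemma cauchy_transform_even_part:
  assumes "continuous_on unit_circle f" "norm z \<noteq> 1"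
  shows "cauchy_transform f z + cauchy_transform f (- z) = 2 * even_cauchy f z"
proof -
  have ne: "\<zeta> - z \<noteq> 0" "\<zeta> + z \<noteq> 0" if "\<zeta> \<in> unit_circle" for \<zeta>
    using that assms(2) by (auto simp: add_eq_0_iff)
  have "cauchy_transform f z + cauchy_transform f (- z)
      = circle_int (\<lambda>\<zeta>. f \<zeta> * (\<zeta> / (\<zeta> - z)) + f \<zeta> * (\<zeta> / (\<zeta> - - z)))"
    by (subst circle_int_add)
      (use ne assms in \<open>auto intro!: continuous_intros simp: cauchy_transform_circle_int\<close>)
  also have "\<dots> = circle_int (\<lambda>\<zeta>. 2 * (f \<zeta> * (\<zeta>\<^sup>2 / (\<zeta>\<^sup>2 - z\<^sup>2))))"
  proof (rule circle_int_cong)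
    fix \<zeta> assume "\<zeta> \<in> unit_circle"
    note n = ne [OF this]
    have "\<zeta>\<^sup>2 - z\<^sup>2 = (\<zeta> - z) * (\<zeta> + z)" by (simp add: power2_eq_square algebra_simps)
    with n show "f \<zeta> * (\<zeta> / (\<zeta> - z)) + f \<zeta> * (\<zeta> / (\<zeta> - - z)) = 2 * (f \<zeta> * (\<zeta>\<^sup>2 / (\<zeta>\<^sup>2 - z\<^sup>2)))"
      by (simp add: divide_simps) (simp add: power2_eq_square algebra_simps)
  qed
  also have "\<dots> = 2 * even_cauchy f z"
    unfolding even_cauchy_def by (rule circle_int_cmult) (rule continuous_on_even_kernel [OF assms])
  finally show ?thesis .
qed

lemma cauchy_transform_holomorphic:
  assumes "continuous_on unit_circle f"
  shows "cauchy_transform f holomorphic_on - unit_circle"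
proof -
  have "cauchy_transform f field_differentiable at z within - unit_circle" if "z \<in> - unit_circle" for z
  proof -
    let ?g = "circlepath 0 1"
    have int: "((\<lambda>u. f u / (u - v) ^ 1) has_contour_integral contour_integral ?g (\<lambda>u. f u / (u - v))) ?g"
      if "v \<in> UNIV - path_image ?g" for v
      unfolding power_one_right
      by (rule has_contour_integral_integral, rule contour_integrable_continuous_circlepath)
        (use assms that in \<open>auto intro!: continuous_intros\<close>)
    have "((\<lambda>v. contour_integral ?g (\<lambda>u. f u / (u - v))) has_field_derivative
            (of_nat 1 * contour_integral ?g (\<lambda>u. f u / (u - z) ^ Suc 1))) (at z)"
    proof (rule Cauchy_next_derivative [where S = UNIV and B = "2 * pi"])
      show "continuous_on (path_image ?g) f" using assms by simp
    qed (use that int in \<open>auto simp: vector_derivative_circlepath norm_mult\<close>)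
    from DERIV_cdivide [OF this, of "2 * of_real pi * \<i>"] show ?thesis
      unfolding cauchy_transform_def [abs_def] field_differentiable_def
      using has_field_derivative_at_within by blast
  qed
  then show ?thesis by (simp add: holomorphic_on_def)
qed

lemma even_cauchy_holomorphic:
  assumes "continuous_on unit_circle f"
  shows "even_cauchy f holomorphic_on - unit_circle"
proof -
  have "(\<lambda>z. (cauchy_transform f z + cauchy_transform f (- z)) / 2) holomorphic_on - unit_circle"
    by (intro holomorphic_intros cauchy_transform_holomorphic [OF assms]
        holomorphic_on_compose_gen [OF _ cauchy_transform_holomorphic [OF assms],
          where f = uminus, unfolded o_def]) auto
  moreover have "(cauchy_transform f z + cauchy_transform f (- z)) / 2 = even_cauchy f z"
    if "z \<in> - unit_circle" for z
    using that cauchy_transform_even_part [OF assms, of z] by simp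
  ultimately show ?thesis by (rule holomorphic_transform)
qed

text \<open>One step of the geometric expansion at the origin, but as an exact identity valid off the whole circle:
  \<open>\<zeta>\<^sup>2 / (\<zeta>\<^sup>2 - z\<^sup>2) = 1 + z\<^sup>2 * \<zeta> powi (- 2) * (\<zeta>\<^sup>2 / (\<zeta>\<^sup>2 - z\<^sup>2))\<close>.\<close>

lemma even_cauchy_at_zero_step:
  assumes "continuous_on unit_circle f" "norm z \<noteq> 1"
  shows "even_cauchy f z = circle_int f + z\<^sup>2 * even_cauchy (\<lambda>\<zeta>. \<zeta> powi (- 2) * f \<zeta>) z"
proof -
  let ?h = "\<lambda>\<zeta>. \<zeta> powi (- 2) * f \<zeta> * (\<zeta>\<^sup>2 / (\<zeta>\<^sup>2 - z\<^sup>2))"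
  have cont: "continuous_on unit_circle ?h"
    by (rule continuous_on_even_kernel [OF _ assms(2)]) (intro continuous_intros assms)
  have "even_cauchy f z = circle_int (\<lambda>\<zeta>. f \<zeta> + z\<^sup>2 * ?h \<zeta>)"
    unfolding even_cauchy_def
  proof (rule circle_int_cong)
    fix \<zeta> assume z: "\<zeta> \<in> unit_circle"
    have "\<zeta> \<noteq> 0" using z by auto
    with circle_square_ne [OF assms(2) z]
    show "f \<zeta> * (\<zeta>\<^sup>2 / (\<zeta>\<^sup>2 - z\<^sup>2)) = f \<zeta> + z\<^sup>2 * ?h \<zeta>"
      by (simp add: power_int_minus field_simps)
  qed
  also have "\<dots> = circle_int f + z\<^sup>2 * even_cauchy (\<lambda>\<zeta>. \<zeta> powi (- 2) * f \<zeta>) z"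
    unfolding even_cauchy_def
    by (simp only: circle_int_add [OF assms(1) continuous_on_mult_left [OF cont]] circle_int_cmult [OF cont])
  finally show ?thesis .
qed

text \<open>The same identity, read in the opposite direction, is one step of the expansion at infinity.\<close>

lemma even_cauchy_at_infinity_step:
  assumes "continuous_on unit_circle f" "norm z \<noteq> 1"
  shows "z\<^sup>2 * even_cauchy f z
    = even_cauchy (\<lambda>\<zeta>. \<zeta> powi 2 * f \<zeta>) z - circle_int (\<lambda>\<zeta>. \<zeta> powi 2 * f \<zeta>)"
proof -
  have "continuous_on unit_circle (\<lambda>\<zeta>. \<zeta> powi 2 * f \<zeta>)"
    by (intro continuous_intros assms)
  from even_cauchy_at_zero_step [OF this assms(2)]
  have "even_cauchy (\<lambda>\<zeta>. \<zeta> powi 2 * f \<zeta>) z = circle_int (\<lambda>\<zeta>. \<zeta> powi 2 * f \<zeta>)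
      + z\<^sup>2 * even_cauchy (\<lambda>\<zeta>. \<zeta> powi (- 2) * (\<zeta> powi 2 * f \<zeta>)) z" .
  moreover have "even_cauchy (\<lambda>\<zeta>. \<zeta> powi (- 2) * (\<zeta> powi 2 * f \<zeta>)) z = even_cauchy f z"
    unfolding even_cauchy_def
    by (rule circle_int_cong) (auto simp: power_int_minus)
  ultimately show ?thesis by simp
qed

text \<open>Orthogonality to \<open>\<zeta> powi (- 2 * k)\<close> for \<open>k < n\<close> removes the constant term from each of the first \<open>n\<close>
  steps, so that a zero of order \<open>2 * n\<close> splits off at the origin.\<close>

lemma even_cauchy_zero_order:
  assumes "continuous_on unit_circle f" "norm z \<noteq> 1"
    and "\<And>k. k < n \<Longrightarrow> circle_int (\<lambda>\<zeta>. \<zeta> powi (- 2 * int k) * f \<zeta>) = 0"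
  shows "even_cauchy f z = z ^ (2 * n) * even_cauchy (\<lambda>\<zeta>. \<zeta> powi (- 2 * int n) * f \<zeta>) z"
  using assms(3)
proof (induction n)
  case (Suc n)
  let ?f = "\<lambda>\<zeta>. \<zeta> powi (- 2 * int n) * f \<zeta>"
  have "continuous_on unit_circle ?f"
    by (intro continuous_intros assms)
  from even_cauchy_at_zero_step [OF this assms(2)] Suc.prems [of n]
  have "even_cauchy ?f z = z\<^sup>2 * even_cauchy (\<lambda>\<zeta>. \<zeta> powi (- 2) * ?f \<zeta>) z" by simp
  also have "even_cauchy (\<lambda>\<zeta>. \<zeta> powi (- 2) * ?f \<zeta>) z
      = even_cauchy (\<lambda>\<zeta>. \<zeta> powi (- 2 * int (Suc n)) * f \<zeta>) z"
    unfolding even_cauchy_def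
  proof (rule circle_int_cong)
    fix \<zeta> :: complex assume "\<zeta> \<in> unit_circle"
    then have "\<zeta> \<noteq> 0" by auto
    then have "\<zeta> powi (- 2 * int (Suc n)) = \<zeta> powi (- 2) * \<zeta> powi (- 2 * int n)"
      by (subst power_int_add [symmetric]) auto
    then show "\<zeta> powi (- 2) * ?f \<zeta> * (\<zeta>\<^sup>2 / (\<zeta>\<^sup>2 - z\<^sup>2))
        = \<zeta> powi (- 2 * int (Suc n)) * f \<zeta> * (\<zeta>\<^sup>2 / (\<zeta>\<^sup>2 - z\<^sup>2))"
      by simp
  qed
  finally show ?case using Suc by (simp add: power_add power2_eq_square mult_ac)
qed simp

lemma even_cauchy_bounded:
  assumes "continuous_on unit_circle f"
  obtains B where "\<And>z. norm z \<ge> 2 \<Longrightarrow> norm (even_cauchy f z) \<le> B"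
proof -
  have "compact (f ` unit_circle)"
    by (rule compact_continuous_image) (use assms in auto)
  then obtain B where B: "B > 0" "\<And>\<zeta>. \<zeta> \<in> unit_circle \<Longrightarrow> norm (f \<zeta>) \<le> B"
    by (metis bounded_pos compact_imp_bounded imageI)
  have "norm (even_cauchy f z) \<le> B" if z: "norm z \<ge> 2" for z
    unfolding even_cauchy_def
  proof (rule norm_circle_int_le)
    show "continuous_on unit_circle (\<lambda>\<zeta>. f \<zeta> * (\<zeta>\<^sup>2 / (\<zeta>\<^sup>2 - z\<^sup>2)))"
      by (rule continuous_on_even_kernel) (use assms z in auto)
    fix \<zeta> :: complex assume \<zeta>: "\<zeta> \<in> unit_circle"
    have "2\<^sup>2 \<le> (norm z)\<^sup>2" using z by (rule power_mono) simp
    then have "1 \<le> norm (z\<^sup>2) - norm (\<zeta>\<^sup>2)" using \<zeta> by (simp add: norm_power)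
    also have "\<dots> \<le> norm (\<zeta>\<^sup>2 - z\<^sup>2)" by (metis norm_minus_commute norm_triangle_ineq2)
    finally have "norm (\<zeta>\<^sup>2 / (\<zeta>\<^sup>2 - z\<^sup>2)) \<le> 1"
      using \<zeta> by (simp add: norm_divide norm_power divide_le_eq_1)
    with B(2) [OF \<zeta>] B(1) show "norm (f \<zeta> * (\<zeta>\<^sup>2 / (\<zeta>\<^sup>2 - z\<^sup>2))) \<le> B"
      unfolding norm_mult using mult_mono [of "norm (f \<zeta>)" B "norm (\<zeta>\<^sup>2 / (\<zeta>\<^sup>2 - z\<^sup>2))" 1] by simp
  qed (use B in auto)
  then show thesis by (rule that)
qed

section \<open>Orthogonal polynomials and their determinants\<close>

lemma poly_as_sum_le:
  fixes p :: "'a::comm_semiring_1 poly"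
  assumes "degree p \<le> n"
  shows "poly p x = (\<Sum>k\<le>n. coeff p k * x ^ k)"
  unfolding poly_altdef
  by (rule sum.mono_neutral_left) (use assms in \<open>auto simp: coeff_eq_0\<close>)

lemma circle_int_poly_moment:
  assumes w: "continuous_on unit_circle w" and p: "degree p \<le> n"
  shows "circle_int (\<lambda>\<zeta>. poly p \<zeta> * \<zeta> powi (- l) * w \<zeta>) = (\<Sum>k\<le>n. coeff p k * moment w (l - int k))"
proof -
  have cont: "continuous_on unit_circle (\<lambda>\<zeta>. w \<zeta> * \<zeta> powi (- i))" for i
    by (intro continuous_intros w)
  have "circle_int (\<lambda>\<zeta>. poly p \<zeta> * \<zeta> powi (- l) * w \<zeta>)
      = circle_int (\<lambda>\<zeta>. \<Sum>k\<le>n. coeff p k * (w \<zeta> * \<zeta> powi (- (l - int k))))"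
  proof (rule circle_int_cong)
    fix \<zeta> :: complex assume "\<zeta> \<in> unit_circle"
    then have "\<zeta> \<noteq> 0" by auto
    then have "\<zeta> ^ k * \<zeta> powi (- l) = \<zeta> powi (- (l - int k))" for k
      using power_int_add [of \<zeta> "int k" "- l"] by simp
    then show "poly p \<zeta> * \<zeta> powi (- l) * w \<zeta> = (\<Sum>k\<le>n. coeff p k * (w \<zeta> * \<zeta> powi (- (l - int k))))"
      unfolding poly_as_sum_le [OF p] sum_distrib_right by (intro sum.cong) (simp_all add: mult_ac)
  qed
  also have "\<dots> = (\<Sum>k\<le>n. coeff p k * moment w (l - int k))"
    unfolding moment_def
    by (simp only: circle_int_sum [OF finite_atMost continuous_on_mult_left [OF cont]] circle_int_cmult [OF cont])
  finally show ?thesis .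
qed

text \<open>The orthogonality relations are a linear system with this matrix, and \<open>Ddet\<close> is its determinant.\<close>

definition moment_mat :: "(complex \<Rightarrow> complex) \<Rightarrow> int \<Rightarrow> nat \<Rightarrow> complex mat" where
  "moment_mat w t n = Matrix.mat n n (\<lambda>(j, k). moment w (2 * int j - int k + t))"

lemma moment_mat_carrier [simp]: "moment_mat w t n \<in> carrier_mat n n"
  by (simp add: moment_mat_def)

lemma Ddet_moment_mat: "Ddet w t n = Determinant.det (moment_mat w t n)"
  by (simp add: Ddet_def moment_mat_def)

lemma moment_mat_mult_vec:
  assumes "v \<in> carrier_vec n" "j < n"
  shows "Matrix.vec_index (moment_mat w t n *\<^sub>v v) j
    = (\<Sum>k<n. Matrix.vec_index v k * moment w (2 * int j + t - int k))"
  using assms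
  by (auto simp: moment_mat_def scalar_prod_def atLeast0LessThan algebra_simps intro!: sum.cong)

text \<open>The leading coefficient is known, which moves its column of moments to the right-hand side and leaves
  a square system for the coefficients below the leading one.\<close>

lemma is_monic_orthogonal_iff:
  assumes w: "continuous_on unit_circle w"
  shows "is_monic_orthogonal w r n p \<longleftrightarrow> degree p = n \<and> coeff p n = 1 \<and>
    moment_mat w r n *\<^sub>v Matrix.vec n (coeff p) = Matrix.vec n (\<lambda>j. - moment w (2 * int j + r - int n))"
    (is "_ \<longleftrightarrow> _ \<and> _ \<and> ?M *\<^sub>v ?c = ?b")
proof (cases "degree p = n \<and> coeff p n = 1")
  case True
  have "circle_int (\<lambda>\<zeta>. poly p \<zeta> * \<zeta> powi (- 2 * int j - r) * w \<zeta>) = 0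
      \<longleftrightarrow> Matrix.vec_index (?M *\<^sub>v ?c) j = Matrix.vec_index ?b j" if "j < n" for j
  proof -
    have "circle_int (\<lambda>\<zeta>. poly p \<zeta> * \<zeta> powi (- 2 * int j - r) * w \<zeta>)
        = (\<Sum>k\<le>n. coeff p k * moment w (2 * int j + r - int k))"
      using circle_int_poly_moment [OF w, of p n "2 * int j + r"] True by simp
    also have "\<dots> = (\<Sum>k<n. coeff p k * moment w (2 * int j + r - int k)) + moment w (2 * int j + r - int n)"
      using True by (simp add: lessThan_Suc_atMost [symmetric])
    finally show ?thesis
      using that moment_mat_mult_vec [of ?c n j w r] by (simp add: eq_neg_iff_add_eq_0)
  qed
  moreover have "?M *\<^sub>v ?c = ?b \<longleftrightarrow> (\<forall>j<n. Matrix.vec_index (?M *\<^sub>v ?c) j = Matrix.vec_index ?b j)"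
  proof (rule iffI)
    assume "\<forall>j<n. Matrix.vec_index (?M *\<^sub>v ?c) j = Matrix.vec_index ?b j"
    then show "?M *\<^sub>v ?c = ?b"
      by (intro eq_vecI) (simp_all add: moment_mat_def del: index_mult_mat_vec)
  qed (simp only: simp_thms)
  ultimately show ?thesis
    using True by (auto simp: is_monic_orthogonal_def)
qed (auto simp: is_monic_orthogonal_def)

lemma smult_one_mat_mult_vec:
  assumes "v \<in> carrier_vec n"
  shows "(a \<cdot>\<^sub>m 1\<^sub>m n) *\<^sub>v v = a \<cdot>\<^sub>v (v :: complex Matrix.vec)"
  using assms by (intro eq_vecI) auto

lemma is_monic_orthogonal_ex1:
  assumes w: "continuous_on unit_circle w" and D: "Ddet w r n \<noteq> 0"
  shows "\<exists>!p. is_monic_orthogonal w r n p"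
proof -
  let ?M = "moment_mat w r n"
  let ?b = "Matrix.vec n (\<lambda>j. - moment w (2 * int j + r - int n))"
  have D': "Determinant.det ?M \<noteq> 0" using D by (simp add: Ddet_moment_mat)
  have adj: "adj_mat ?M \<in> carrier_mat n n" "?M * adj_mat ?M = Determinant.det ?M \<cdot>\<^sub>m 1\<^sub>m n"
    "adj_mat ?M * ?M = Determinant.det ?M \<cdot>\<^sub>m 1\<^sub>m n"
    using adj_mat [OF moment_mat_carrier [of w r n]] by auto
  define x where "x = (1 / Determinant.det ?M) \<cdot>\<^sub>v (adj_mat ?M *\<^sub>v ?b)"
  have x: "x \<in> carrier_vec n" unfolding x_def using adj(1) by auto
  have "?M *\<^sub>v (adj_mat ?M *\<^sub>v ?b) = Determinant.det ?M \<cdot>\<^sub>v ?b"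
    using assoc_mult_mat_vec [OF moment_mat_carrier adj(1), of ?b w r] adj(2)
    by (simp add: smult_one_mat_mult_vec)
  then have Mx: "?M *\<^sub>v x = ?b"
    unfolding x_def using D' adj(1)
    by (subst mult_mat_vec [OF moment_mat_carrier]) (auto simp: smult_smult_assoc)
  define p where "p = monom 1 n + (\<Sum>k<n. monom (Matrix.vec_index x k) k)"
  have coeff_p: "coeff p k = (if k = n then 1 else if k < n then Matrix.vec_index x k else 0)" for k
    by (auto simp: p_def coeff_sum)
  have "degree p = n"
    by (rule antisym) (auto intro!: degree_le le_degree simp: coeff_p)
  moreover have "Matrix.vec n (coeff p) = x"
    using x by (intro eq_vecI) (auto simp: coeff_p)
  ultimately have ex: "is_monic_orthogonal w r n p"
    unfolding is_monic_orthogonal_iff [OF w] using Mx by (simp add: coeff_p)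
  show ?thesis
  proof (rule ex1I [of _ p])
    fix q assume "is_monic_orthogonal w r n q"
    then have q: "degree q = n" "coeff q n = 1" "?M *\<^sub>v Matrix.vec n (coeff q) = ?b"
      unfolding is_monic_orthogonal_iff [OF w] by auto
    have inj: "v = (1 / Determinant.det ?M) \<cdot>\<^sub>v (adj_mat ?M *\<^sub>v (?M *\<^sub>v v))" if "v \<in> carrier_vec n" for v
    proof -
      have "adj_mat ?M *\<^sub>v (?M *\<^sub>v v) = Determinant.det ?M \<cdot>\<^sub>v v"
        using assoc_mult_mat_vec [OF adj(1) moment_mat_carrier that, symmetric] adj(3) that
        by (simp add: smult_one_mat_mult_vec)
      then show ?thesis using D' that by (auto simp: smult_smult_assoc)
    qed
    have "Matrix.vec n (coeff q) = x"
      unfolding x_def q(3) [symmetric] by (rule inj) auto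
    then have qx: "coeff q k = Matrix.vec_index x k" if "k < n" for k
      using that by (metis index_vec)
    show "q = p"
    proof (rule poly_eqI)
      fix k show "coeff q k = coeff p k"
        using q qx by (cases k n rule: linorder_cases) (auto simp: coeff_p coeff_eq_0)
    qed
  qed (rule ex)
qed

lemma Ppoly_is_monic_orthogonal:
  assumes "continuous_on unit_circle w" "Ddet w r n \<noteq> 0"
  shows "is_monic_orthogonal w r n (Ppoly w r n)"
  unfolding Ppoly_def by (rule theI') (rule is_monic_orthogonal_ex1 [OF assms])

text \<open>The coefficient vector of \<open>Ppoly w r n\<close> is mapped by the larger moment matrix \<open>moment_mat w (r - 2) (n + 1)\<close> to
  a multiple of the first unit vector: the rows after the first one are the orthogonality relations, and
  the first row gives the moment in question. As the polynomial is monic, replacing the last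
  column by this image keeps the determinant (Cramer's rule), and expanding along that column leaves a single minor,
  which is the determinant of \<open>moment_mat w r n\<close>.\<close>

lemma first_moment_Ppoly:
  assumes w: "continuous_on unit_circle w" and D: "Ddet w r n \<noteq> 0"
  shows "circle_int (\<lambda>\<zeta>. poly (Ppoly w r n) \<zeta> * \<zeta> powi (2 - r) * w \<zeta>)
    = (- 1) ^ n * (Ddet w (r - 2) (n + 1) / Ddet w r n)"
proof -
  let ?p = "Ppoly w r n" and ?B = "moment_mat w (r - 2) (Suc n)"
  let ?c = "Matrix.vec (Suc n) (coeff ?p)"
  define h where "h = circle_int (\<lambda>\<zeta>. poly ?p \<zeta> * \<zeta> powi (2 - r) * w \<zeta>)"
  have p: "degree ?p = n" "coeff ?p n = 1"
      "\<And>k. k < n \<Longrightarrow> circle_int (\<lambda>\<zeta>. poly ?p \<zeta> * \<zeta> powi (- 2 * int k - r) * w \<zeta>) = 0"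
    using Ppoly_is_monic_orthogonal [OF assms] by (auto simp: is_monic_orthogonal_def)
  have Bc: "Matrix.vec_index (?B *\<^sub>v ?c) j = (if j = 0 then h else 0)" if j: "j < Suc n" for j
  proof -
    have "Matrix.vec_index (?B *\<^sub>v ?c) j = (\<Sum>k\<le>n. coeff ?p k * moment w (2 * int j + (r - 2) - int k))"
      using moment_mat_mult_vec [of ?c "Suc n" j w "r - 2"] j by (simp add: lessThan_Suc_atMost)
    also have "\<dots> = circle_int (\<lambda>\<zeta>. poly ?p \<zeta> * \<zeta> powi (- (2 * int j + (r - 2))) * w \<zeta>)"
      by (rule circle_int_poly_moment [OF w, symmetric]) (simp add: p)
    also have "\<dots> = (if j = 0 then h else 0)"
    proof (cases j)
      case (Suc i)
      then have "- (2 * int j + (r - 2)) = - 2 * int i - r" by simp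
      then show ?thesis using p(3) [of i] j Suc by (simp only:) simp
    qed (simp add: h_def)
    finally show ?thesis .
  qed
  \<comment> \<open>\<open>?B *\<^sub>v ?c\<close> has \<open>h\<close> in position \<open>0\<close> and zeros elsewhere.\<close>
  let ?R = "replace_col ?B (?B *\<^sub>v ?c) n"
  have R: "?R \<in> carrier_mat (Suc n) (Suc n)"
    by (simp add: replace_col_def moment_mat_def)
  have "Determinant.det ?R = Matrix.vec_index ?c n * Determinant.det ?B"
    by (rule cramer_lemma_mat [where n = "Suc n"]) auto
  then have "Ddet w (r - 2) (n + 1) = Determinant.det ?R"
    using p by (simp add: Ddet_moment_mat)
  also have "\<dots> = (\<Sum>i<Suc n. ?R $$ (i, n) * cofactor ?R i n)"
    by (rule laplace_expansion_column [OF R]) simp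
  also have "\<dots> = (\<Sum>i<Suc n. (if i = 0 then h * cofactor ?R 0 n else 0))"
  proof (rule sum.cong)
    fix i assume "i \<in> {..<Suc n}"
    then have "?R $$ (i, n) = (if i = 0 then h else 0)"
      using Bc [of i] by (simp add: replace_col_def moment_mat_def)
    then show "?R $$ (i, n) * cofactor ?R i n = (if i = 0 then h * cofactor ?R 0 n else 0)"
      by auto
  qed simp
  also have "\<dots> = h * cofactor ?R 0 n" by simp
  also have "cofactor ?R 0 n = (- 1) ^ n * Ddet w r n"
  proof -
    have "mat_delete ?R 0 n = moment_mat w r n"
      by (rule eq_matI)
        (auto simp: mat_delete_def replace_col_def moment_mat_def intro!: arg_cong [of _ _ "moment w"])
    then show ?thesis by (simp add: cofactor_def Ddet_moment_mat)
  qed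
  finally have "Ddet w (r - 2) (n + 1) = h * ((- 1) ^ n * Ddet w r n)" .
  with D have "h = (- 1) ^ n * (Ddet w (r - 2) (n + 1) / Ddet w r n)"
    by (simp add: field_simps flip: power_mult_distrib)
  then show ?thesis by (simp add: h_def)
qed

section \<open>Second-order expansions at infinity\<close>

definition expands2 :: "(complex \<Rightarrow> complex) \<Rightarrow> complex \<Rightarrow> complex \<Rightarrow> complex \<Rightarrow> bool" where
  "expands2 f a b c \<longleftrightarrow> (\<lambda>z. f z - (a + b / z + c / z\<^sup>2)) \<in> O[at_infinity](\<lambda>z. z powi (- 3))"

text \<open>The case distinctions concern the degenerate degrees \<open>N < 2\<close>, where truncated
  subtraction would otherwise produce a wrong index. The proof passes to the reversed polynomial, which expresses
  \<open>poly p z / z ^ N\<close> as a polynomial in \<open>1 / z\<close>.\<close>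

lemma expands2_poly:
  fixes p :: "complex poly"
  assumes "degree p \<le> N"
  shows "expands2 (\<lambda>z. poly p z / z ^ N) (coeff p N)
    (if N \<ge> 1 then coeff p (N - 1) else 0) (if N \<ge> 2 then coeff p (N - 2) else 0)"
proof -
  define s where "s = monom 1 (N - degree p) * reflect_poly p"
  have cs: "coeff s k = (if k \<le> N then coeff p (N - k) else 0)" for k
    using assms by (auto simp: s_def coeff_monom_mult coeff_reflect_poly coeff_eq_0)
  have ps: "poly p z / z ^ N = poly s (inverse z)" if "z \<noteq> 0" for z
  proof -
    have "poly s (inverse z) = inverse z ^ (N - degree p) * inverse z ^ degree p * poly p z"
      using that by (simp add: s_def poly_monom poly_reflect_poly_nz)
    also have "\<dots> = poly p z / z ^ N"
      using assms power_add [of "inverse z" "N - degree p" "degree p"]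
      by (simp add: divide_inverse power_inverse)
    finally show ?thesis by simp
  qed
  obtain a0 a1 a2 t where s: "s = pCons a0 (pCons a1 (pCons a2 t))"
    by (metis pCons_cases)
  have a: "a0 = coeff s 0" "a1 = coeff s 1" "a2 = coeff s 2"
    by (simp_all add: s numeral_2_eq_2)
  have inv: "filterlim (inverse :: complex \<Rightarrow> complex) (nhds 0) at_infinity"
    by (rule tendsto_inverse_0)
  have "((\<lambda>z. poly t (inverse z)) \<longlongrightarrow> poly t 0) at_infinity"
    by (rule tendsto_poly [OF inv])
  then have "(\<lambda>z. poly t (inverse z)) \<in> O[at_infinity](\<lambda>_. 1)"
    by (intro bigoI_tendsto [where c = "poly t 0"]) auto
  then have "(\<lambda>z. z powi (- 3) * poly t (inverse z)) \<in> O[at_infinity](\<lambda>z. z powi (- 3) * 1)"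
    by (intro landau_o.big.mult landau_o.big_refl)
  moreover have "\<forall>\<^sub>F z in at_infinity. z powi (- 3) * poly t (inverse z)
      = poly p z / z ^ N - (coeff s 0 + coeff s 1 / z + coeff s 2 / z\<^sup>2)"
    using eventually_not_equal_at_infinity [of 0]
  proof eventually_elim
    case (elim z)
    then show ?case
      unfolding ps [OF elim] a [symmetric]
      by (simp add: s power_int_minus divide_inverse power3_eq_cube power2_eq_square algebra_simps)
  qed
  ultimately have "(\<lambda>z. poly p z / z ^ N - (coeff s 0 + coeff s 1 / z + coeff s 2 / z\<^sup>2))
      \<in> O[at_infinity](\<lambda>z. z powi (- 3))"
    by (simp add: landau_o.big.in_cong)
  then show ?thesis
    unfolding expands2_def cs by (simp only: le0 if_True diff_zero)
qed

text \<open>Three steps of the expansion at infinity; the remainder after them is bounded because its kernel is.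
  Only even powers occur, hence the vanishing coefficient of \<open>1 / z\<close>.\<close>

lemma expands2_even_cauchy:
  assumes "continuous_on unit_circle f"
  shows "\<exists>c. expands2 (\<lambda>z. 2 * z\<^sup>2 * even_cauchy f z) (- 2 * circle_int (\<lambda>\<zeta>. \<zeta> powi 2 * f \<zeta>)) 0 c"
proof -
  \<comment> \<open>The integrands after one, two and three steps.\<close>
  define g1 g2 g3 where "g1 = (\<lambda>\<zeta>. \<zeta> powi 2 * f \<zeta>)" and "g2 = (\<lambda>\<zeta>. \<zeta> powi 2 * g1 \<zeta>)"
    and "g3 = (\<lambda>\<zeta>. \<zeta> powi 2 * g2 \<zeta>)"
  have cont: "continuous_on unit_circle g1" "continuous_on unit_circle g2" "continuous_on unit_circle g3"
    unfolding g1_def g2_def g3_def by (intro continuous_intros assms)+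
  obtain B where B: "\<And>z. norm z \<ge> 2 \<Longrightarrow> norm (even_cauchy g3 z) \<le> B"
    using even_cauchy_bounded [OF cont(3)] by blast
  define K where "K = 2 * (B + norm (circle_int g3))"
  have "(\<lambda>z. 2 * z\<^sup>2 * even_cauchy f z - (- 2 * circle_int g1 + 0 / z + (- 2 * circle_int g2) / z\<^sup>2))
      \<in> O[at_infinity](\<lambda>z. z powi (- 3))"
  proof (rule bigoI [where c = K])
    show "\<forall>\<^sub>F z in at_infinity. norm (2 * z\<^sup>2 * even_cauchy f z
        - (- 2 * circle_int g1 + 0 / z + (- 2 * circle_int g2) / z\<^sup>2)) \<le> K * norm (z powi (- 3))"
      unfolding eventually_at_infinity
    proof (intro exI allI impI)
      fix z :: complex assume z: "norm z \<ge> 2"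
      have z0: "z \<noteq> 0" "norm z \<noteq> 1" using z by auto
      have 1: "z\<^sup>2 * even_cauchy f z = even_cauchy g1 z - circle_int g1"
        using even_cauchy_at_infinity_step [OF assms z0(2)] by (simp add: g1_def)
      have 2: "z\<^sup>2 * even_cauchy g1 z = even_cauchy g2 z - circle_int g2"
        using even_cauchy_at_infinity_step [OF cont(1) z0(2)] by (simp add: g2_def)
      have 3: "z\<^sup>2 * even_cauchy g2 z = even_cauchy g3 z - circle_int g3"
        using even_cauchy_at_infinity_step [OF cont(2) z0(2)] by (simp add: g3_def)
      have "2 * z\<^sup>2 * even_cauchy f z - (- 2 * circle_int g1 + 0 / z + (- 2 * circle_int g2) / z\<^sup>2)
          = 2 * even_cauchy g1 z + 2 * circle_int g2 / z\<^sup>2"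
        by (simp add: mult.assoc 1)
      also have "\<dots> = 2 * even_cauchy g2 z / z\<^sup>2"
      proof -
        have "even_cauchy g1 z = (even_cauchy g2 z - circle_int g2) / z\<^sup>2"
          using 2 z0 by (simp add: field_simps)
        then show ?thesis by (simp add: diff_divide_distrib)
      qed
      also have "\<dots> = 2 * (even_cauchy g3 z - circle_int g3) / z ^ 4"
        unfolding 3 [symmetric] using z0 by (simp add: field_simps)
      finally have eq: "2 * z\<^sup>2 * even_cauchy f z - (- 2 * circle_int g1 + 0 / z + (- 2 * circle_int g2) / z\<^sup>2)
          = 2 * (even_cauchy g3 z - circle_int g3) / z ^ 4" .
      have "norm (2 * (even_cauchy g3 z - circle_int g3)) \<le> K"
        unfolding K_def norm_mult
        using norm_triangle_ineq4 [of "even_cauchy g3 z" "circle_int g3"] B [OF z] by simp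
      moreover have "norm z ^ 3 \<le> norm z ^ 4" by (rule power_increasing) (use z in auto)
      moreover have "K \<ge> 0" using calculation(1) norm_ge_zero order_trans by blast
      ultimately have "norm (2 * (even_cauchy g3 z - circle_int g3)) / norm z ^ 4 \<le> K / norm z ^ 3"
        using z0 by (intro frac_le) auto
      then show "norm (2 * z\<^sup>2 * even_cauchy f z
          - (- 2 * circle_int g1 + 0 / z + (- 2 * circle_int g2) / z\<^sup>2)) \<le> K * norm (z powi (- 3))"
        unfolding eq norm_divide norm_power norm_power_int by (simp add: power_int_minus divide_inverse)
    qed
  qed
  then show ?thesis unfolding expands2_def g1_def by blast
qed

lemma expands2_cong:
  assumes "expands2 f a b c" "\<forall>\<^sub>F z in at_infinity. f z = g z"
  shows "expands2 g a b c"
proof -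
  have "\<forall>\<^sub>F z in at_infinity. f z - (a + b / z + c / z\<^sup>2) = g z - (a + b / z + c / z\<^sup>2)"
    using assms(2) by eventually_elim simp
  from landau_o.big.in_cong [OF this] show ?thesis
    using assms(1) unfolding expands2_def by blast
qed

section \<open>Odd parts of polynomials\<close>

text \<open>The polynomial that extends \<open>Dfun\<close> over the origin.\<close>

definition odd_quotient :: "complex poly \<Rightarrow> complex poly" where
  "odd_quotient p = poly_shift 1 (smult (1 / 2) (p - pcompose p [:0, - 1:]))"

lemma coeff_odd_quotient: "coeff (odd_quotient p) k = (if even k then coeff p (Suc k) else 0)"
  by (simp add: odd_quotient_def coeff_poly_shift coeff_pcompose_linear)

lemma poly_odd_quotient: "2 * z * poly (odd_quotient p) z = poly p z - poly p (- z)"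
proof -
  let ?d = "smult (1 / 2) (p - pcompose p [:0, - 1:])"
  have "pCons 0 (odd_quotient p) = ?d"
    by (rule poly_eqI)
      (auto simp: odd_quotient_def coeff_poly_shift coeff_pCons coeff_pcompose_linear split: nat.split)
  then have "z * poly (odd_quotient p) z = poly ?d z"
    by (metis poly_pCons add_0)
  then have "2 * z * poly (odd_quotient p) z = 2 * poly ?d z" by (simp only: mult.assoc)
  also have "\<dots> = poly p z - poly p (- z)" by (simp add: poly_pcompose)
  finally show ?thesis .
qed

lemma degree_odd_quotient_le:
  assumes "degree p \<le> 2 * m"
  shows "degree (odd_quotient p) \<le> 2 * m - 2"
proof (rule degree_le, intro allI impI)
  fix k assume k: "2 * m - 2 < k"
  show "coeff (odd_quotient p) k = 0"
  proof (cases "even k")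
    case True
    with k have "2 * m \<le> k" by (auto elim!: evenE)
    with assms show ?thesis by (simp add: coeff_odd_quotient coeff_eq_0)
  qed (simp add: coeff_odd_quotient)
qed

section \<open>Three-by-three matrix functions\<close>

lemma tendsto_matrix_mult_left:
  fixes A :: "complex^3^3"
  assumes "(F \<longlongrightarrow> L) G"
  shows "((\<lambda>z. A ** F z) \<longlongrightarrow> A ** L) G"
  unfolding matrix_matrix_mult_def
  by (intro tendsto_vec_lambda tendsto_sum tendsto_mult tendsto_const tendsto_vec_nth assms)

lemma continuous_on_matrix_mult_left:
  fixes A :: "complex^3^3"
  shows "continuous_on S F \<Longrightarrow> continuous_on S (\<lambda>z. A ** F z)"
  unfolding continuous_on_def by (blast intro: tendsto_matrix_mult_left)

lemma has_boundary_values_matrix_mult_left: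
  fixes A :: "complex^3^3"
  assumes "has_boundary_values F Fp Fm"
  shows "has_boundary_values (\<lambda>z. A ** F z) (\<lambda>z. A ** Fp z) (\<lambda>z. A ** Fm z)"
  using assms unfolding has_boundary_values_def
  by (blast intro: tendsto_matrix_mult_left continuous_on_matrix_mult_left)

text \<open>The point \<open>0\<close> is excluded because the formulas below hold only for \<open>z \<noteq> 0\<close>, and boundary values do
  not see it.\<close>

lemma has_boundary_values_cong:
  assumes "has_boundary_values F Fp Fm" "\<And>z. z \<in> - unit_circle - {0} \<Longrightarrow> F z = G z"
  shows "has_boundary_values G Fp Fm"
proof -
  have ev: "\<forall>\<^sub>F u in at z within S. F u = G u"
    if "S \<subseteq> - unit_circle" for S z
  proof -
    have "\<forall>\<^sub>F u in at z within S. u \<in> S" by (simp add: eventually_at_filter)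
    with eventually_neq_at_within [of 0 z S] show ?thesis
      by eventually_elim (use that assms(2) in auto)
  qed
  have "ball 0 1 \<subseteq> - unit_circle" "- cball 0 1 \<subseteq> - unit_circle" by auto
  note sides = tendsto_cong [OF ev [OF this(1)]] tendsto_cong [OF ev [OF this(2)]]
  show ?thesis
    using assms(1) by (simp add: has_boundary_values_def sides)
qed

text \<open>Reflection preserves each side of the circle. This treats the reflected half of \<open>even_cauchy\<close>.\<close>

lemma has_boundary_values_reflect:
  assumes "has_boundary_values F Fp Fm"
  shows "has_boundary_values (\<lambda>z. F (- z)) (\<lambda>z. Fp (- z)) (\<lambda>z. Fm (- z))"
proof -
  have lim: "filterlim uminus (at (- z) within S) (at z within S)"
    if "uminus ` S \<subseteq> S" for z :: complex and S
  proof -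
    have "\<forall>\<^sub>F u in at z within S. - u \<in> S \<and> - u \<noteq> - z"
      unfolding eventually_at_filter by (rule always_eventually) (use that in auto)
    then show ?thesis unfolding filterlim_at by (auto intro!: tendsto_intros)
  qed
  have cont: "continuous_on unit_circle (\<lambda>z. H (- z))" if "continuous_on unit_circle H" for H :: "complex \<Rightarrow> 'a"
    by (rule continuous_on_compose2 [OF that]) (auto intro!: continuous_intros)
  show ?thesis
    unfolding has_boundary_values_def
  proof (intro conjI ballI)
    fix z :: complex assume "z \<in> unit_circle"
    then have z: "- z \<in> unit_circle" by simp
    show "((\<lambda>z. F (- z)) \<longlongrightarrow> Fp (- z)) (at z within ball 0 1)"
      using assms z by (intro filterlim_compose [OF _ lim]) (auto simp: has_boundary_values_def)
    show "((\<lambda>z. F (- z)) \<longlongrightarrow> Fm (- z)) (at z within - cball 0 1)"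
      using assms z by (intro filterlim_compose [OF _ lim]) (auto simp: has_boundary_values_def)
  qed (use assms cont in \<open>auto simp: has_boundary_values_def\<close>)
qed

lemma has_boundary_values_add:
  fixes F :: "complex \<Rightarrow> complex"
  assumes "has_boundary_values F Fp Fm" "has_boundary_values G Gp Gm"
  shows "has_boundary_values (\<lambda>z. F z + G z) (\<lambda>z. Fp z + Gp z) (\<lambda>z. Fm z + Gm z)"
  using assms unfolding has_boundary_values_def
  by (auto intro!: continuous_intros tendsto_intros)

lemma has_boundary_values_mult:
  fixes F :: "complex \<Rightarrow> complex"
  assumes "has_boundary_values F Fp Fm" "has_boundary_values G Gp Gm"
  shows "has_boundary_values (\<lambda>z. F z * G z) (\<lambda>z. Fp z * Gp z) (\<lambda>z. Fm z * Gm z)"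
  using assms unfolding has_boundary_values_def
  by (auto intro!: continuous_intros tendsto_intros)

lemma has_boundary_values_isCont:
  assumes "\<And>z. z \<in> unit_circle \<Longrightarrow> isCont F z"
  shows "has_boundary_values F F F"
  using assms unfolding has_boundary_values_def
  by (auto intro!: continuous_at_imp_continuous_on intro: Lim_at_imp_Lim_at_within simp: isCont_def)

lemma has_boundary_values_matrix:
  fixes F :: "complex \<Rightarrow> complex^3^3"
  assumes "\<And>i j. has_boundary_values (\<lambda>z. F z $ i $ j) (\<lambda>z. Fp z $ i $ j) (\<lambda>z. Fm z $ i $ j)"
  shows "has_boundary_values F Fp Fm"
  using assms unfolding has_boundary_values_def continuous_on_def
  by (auto intro!: vec_tendstoI)

lemma matrix_inv_mult:
  fixes A :: "'a::semiring_1^'n^'m"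
  assumes "invertible A"
  shows "A ** matrix_inv A = mat 1" "matrix_inv A ** A = mat 1"
  using someI_ex [OF assms [unfolded invertible_def]] unfolding matrix_inv_def by blast+

text \<open>Normalising a matrix function by its limit \<open>A\<close> at infinity acts linearly on its expansion.\<close>

lemma normalised_expansion:
  fixes A B1 B2 :: "complex^3^3" and N :: "complex \<Rightarrow> complex^3^3"
  assumes A: "invertible A"
    and N: "\<And>i j. expands2 (\<lambda>z. N z $ i $ j) (A $ i $ j) (B1 $ i $ j) (B2 $ i $ j)"
  obtains E :: "complex \<Rightarrow> complex^3^3" where "\<And>i j. (\<lambda>z. E z $ i $ j) \<in> O[at_infinity](\<lambda>z. z powi (- 3))"
    and "\<And>z. matrix_inv A ** N z = mat 1 + map_matrix (\<lambda>y. y / z) (matrix_inv A ** B1)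
      + map_matrix (\<lambda>y. y / z\<^sup>2) (matrix_inv A ** B2) + E z"
proof -
  define R where "R z = N z - (A + map_matrix (\<lambda>y. y / z) B1 + map_matrix (\<lambda>y. y / z\<^sup>2) B2)" for z
  have R: "(\<lambda>z. R z $ i $ j) \<in> O[at_infinity](\<lambda>z. z powi (- 3))" for i j
    using N [of i j] by (simp add: R_def expands2_def map_matrix_def)
  have scale: "C ** map_matrix (\<lambda>y. y / x) B = map_matrix (\<lambda>y. y / x) (C ** B)"
    for C B :: "complex^3^3" and x
    by (simp add: vec_eq_iff matrix_matrix_mult_def map_matrix_def sum_divide_distrib)
  show thesis
  proof (rule that)
    show "(\<lambda>z. (matrix_inv A ** R z) $ i $ j) \<in> O[at_infinity](\<lambda>z. z powi (- 3))" for i j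
      unfolding matrix_matrix_mult_def by (simp, intro big_sum_in_bigo) (simp add: R)
    fix z
    have "N z = A + map_matrix (\<lambda>y. y / z) B1 + map_matrix (\<lambda>y. y / z\<^sup>2) B2 + R z"
      by (simp add: R_def)
    then show "matrix_inv A ** N z = mat 1 + map_matrix (\<lambda>y. y / z) (matrix_inv A ** B1)
      + map_matrix (\<lambda>y. y / z\<^sup>2) (matrix_inv A ** B2) + matrix_inv A ** R z"
      by (simp add: matrix_add_ldistrib scale matrix_inv_mult(2) [OF A])
  qed
qed

section \<open>The unnormalised matrix\<close>

text \<open>The jump of the Cauchy transform of \<open>w\<close> itself is \<open>w\<close>, and both boundary values are continuous.\<close>

lemma regular_symbol_continuous:
  assumes "regular_symbol w"
  shows "continuous_on unit_circle w"
proof -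
  obtain Fp Fm where F: "continuous_on unit_circle Fp" "continuous_on unit_circle Fm"
      "\<And>z. z \<in> unit_circle \<Longrightarrow> Fp z - Fm z = w z * (z powi 0 * poly 1 z)"
    using assms unfolding regular_symbol_def plemelj_sokhotskii_def has_boundary_values_def by blast
  have "continuous_on unit_circle (\<lambda>z. Fp z - Fm z)"
    by (intro continuous_intros F)
  then show ?thesis
    by (rule continuous_on_eq) (use F(3) in simp)
qed

text \<open>Bracketed so as to be literally a symbol times a Laurent polynomial, to which the Plemelj-Sokhotskii
  hypothesis applies.\<close>

definition weighted_Ppoly :: "(complex \<Rightarrow> complex) \<Rightarrow> int \<Rightarrow> nat \<Rightarrow> complex \<Rightarrow> complex" where
  "weighted_Ppoly w r n \<zeta> = w \<zeta> * (\<zeta> powi (- r) * poly (Ppoly w r n) \<zeta>)"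

lemma continuous_on_weighted_Ppoly:
  "continuous_on unit_circle w \<Longrightarrow> continuous_on unit_circle (weighted_Ppoly w r n)"
  unfolding weighted_Ppoly_def by (intro continuous_intros)

lemma Gfun_even_cauchy:
  "Gfun w r n z = 2 * z powi (- 2 * int n) * even_cauchy (weighted_Ppoly w r n) z"
  by (simp add: Gfun_def even_cauchy_def weighted_Ppoly_def mult_ac)

lemma powi_weighted_Ppoly:
  assumes "\<zeta> \<in> unit_circle"
  shows "\<zeta> powi k * weighted_Ppoly w r n \<zeta> = poly (Ppoly w r n) \<zeta> * \<zeta> powi (k - r) * w \<zeta>"
proof -
  have "\<zeta> \<noteq> 0" using assms by auto
  then have "\<zeta> powi (k - r) = \<zeta> powi k * \<zeta> powi (- r)"
    by (simp add: power_int_diff power_int_minus divide_inverse)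
  then show ?thesis by (simp add: weighted_Ppoly_def)
qed

text \<open>This is where the definition of \<open>Ppoly\<close> enters: the factor \<open>z ^ (2 * n)\<close> cancels the pole of \<open>Gfun\<close> at
  the origin.\<close>

lemma even_cauchy_weighted_Ppoly:
  assumes w: "continuous_on unit_circle w" and D: "Ddet w r n \<noteq> 0" and z: "norm z \<noteq> 1"
  shows "even_cauchy (weighted_Ppoly w r n) z
    = z ^ (2 * n) * even_cauchy (\<lambda>\<zeta>. \<zeta> powi (- 2 * int n) * weighted_Ppoly w r n \<zeta>) z"
proof (rule even_cauchy_zero_order [OF continuous_on_weighted_Ppoly [OF w] z])
  fix k assume "k < n"
  have "circle_int (\<lambda>\<zeta>. \<zeta> powi (- 2 * int k) * weighted_Ppoly w r n \<zeta>)
      = circle_int (\<lambda>\<zeta>. poly (Ppoly w r n) \<zeta> * \<zeta> powi (- 2 * int k - r) * w \<zeta>)"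
    by (rule circle_int_cong) (rule powi_weighted_Ppoly)
  also have "\<dots> = 0"
    using Ppoly_is_monic_orthogonal [OF w D] \<open>k < n\<close> by (auto simp: is_monic_orthogonal_def)
  finally show "circle_int (\<lambda>\<zeta>. \<zeta> powi (- 2 * int k) * weighted_Ppoly w r n \<zeta>) = 0" .
qed

lemma gcoeff_first_moment:
  assumes w: "continuous_on unit_circle w" and D: "Ddet w r n \<noteq> 0"
  shows "gcoeff w r n = - 2 * circle_int (\<lambda>\<zeta>. \<zeta> powi 2 * weighted_Ppoly w r n \<zeta>)"
proof -
  have "circle_int (\<lambda>\<zeta>. \<zeta> powi 2 * weighted_Ppoly w r n \<zeta>)
      = circle_int (\<lambda>\<zeta>. poly (Ppoly w r n) \<zeta> * \<zeta> powi (2 - r) * w \<zeta>)"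
    by (rule circle_int_cong) (rule powi_weighted_Ppoly)
  then show ?thesis
    using first_moment_Ppoly [OF assms] by (simp add: gcoeff_def)
qed

definition row_degree :: "nat \<Rightarrow> 3 \<Rightarrow> nat" where
  "row_degree m i = (if i = 1 then 2 * m else if i = 2 then 2 * m - 1 else 2 * m - 2)"

text \<open>The matrix that the inverse of \<open>Amat\<close> multiplies in \<open>Yformula\<close>, with its removable singularity at the
  origin filled in. In row \<open>i\<close> the exponent \<open>2 * (n + 2 - 2 * m)\<close> is \<open>4\<close>, \<open>2\<close>, \<open>0\<close> in turn.\<close>

definition Yraw :: "(complex \<Rightarrow> complex) \<Rightarrow> int \<Rightarrow> nat \<Rightarrow> complex \<Rightarrow> complex^3^3" where
  "Yraw w r m z = (\<chi> i j. let n = row_degree m i; p = Ppoly w r n in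
     if j = 1 then poly p z
     else if j = 2 then poly (odd_quotient p) z
     else 2 * z ^ (2 * (n + 2 - 2 * m)) * even_cauchy (\<lambda>\<zeta>. \<zeta> powi (- 2 * int n) * weighted_Ppoly w r n \<zeta>) z)"

lemma three_cases: obtains "i = (1::3)" | "i = 2" | "i = 3"
  using exhaust_3 by blast

text \<open>The exponents \<open>4\<close>, \<open>2\<close>, \<open>0\<close> compensate for the different degrees, so that all three rows carry the same
  power of \<open>z\<close>. Hence a single jump matrix serves all rows.\<close>

lemma Yraw_third_column:
  assumes w: "continuous_on unit_circle w" and m: "m \<ge> 1" and D: "Ddet w r (row_degree m i) \<noteq> 0"
    and z: "norm z \<noteq> 1" "z \<noteq> 0"
  shows "Yraw w r m z $ i $ 3 = 2 * z powi (4 - 4 * int m) * even_cauchy (weighted_Ppoly w r (row_degree m i)) z"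
proof -
  define n where "n = row_degree m i"
  have n: "2 * m \<le> n + 2" using m by (auto simp: n_def row_degree_def)
  have "z ^ (2 * (n + 2 - 2 * m)) = z powi (4 - 4 * int m) * z ^ (2 * n)"
  proof -
    have "z powi (4 - 4 * int m) * z ^ (2 * n) = z powi (4 - 4 * int m + int (2 * n))"
      using power_int_add [of z "4 - 4 * int m" "int (2 * n)"] z by (simp only: power_int_of_nat) simp
    also have "4 - 4 * int m + int (2 * n) = int (2 * (n + 2 - 2 * m))" using n by simp
    finally show ?thesis by (simp only: power_int_of_nat)
  qed
  then show ?thesis
    using even_cauchy_weighted_Ppoly [OF w D z(1)] by (simp add: Yraw_def Let_def n_def [symmetric])
qed

lemma Yformula_Yraw:
  assumes w: "continuous_on unit_circle w" and m: "m \<ge> 1" and D: "\<And>i. Ddet w r (row_degree m i) \<noteq> 0"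
    and z: "norm z \<noteq> 1" "z \<noteq> 0"
  shows "Yformula w r m z = matrix_inv (Amat w r m) ** Yraw w r m z"
proof -
  have Dfun: "Dfun w r n z = poly (odd_quotient (Ppoly w r n)) z" for n
    using poly_odd_quotient [of z "Ppoly w r n"] z by (simp add: Dfun_def field_simps)
  have G: "z ^ (2 * (row_degree m i + 2 - 2 * m)) * Gfun w r (row_degree m i) z = Yraw w r m z $ i $ 3" for i
  proof -
    have "Gfun w r n z = 2 * even_cauchy (\<lambda>\<zeta>. \<zeta> powi (- 2 * int n) * weighted_Ppoly w r n \<zeta>) z"
      if "n = row_degree m i" for n
    proof -
      have "z powi (- 2 * int n) * z ^ (2 * n) = 1"
        using z power_int_minus [of z "2 * int n"] power_int_of_nat [of z "2 * n"] by simp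
      then show ?thesis
        unfolding Gfun_even_cauchy using even_cauchy_weighted_Ppoly [OF w D [of i] z(1)] that
        by (simp add: mult_ac)
    qed
    then show ?thesis by (simp add: Yraw_def Let_def)
  qed
  have "vector [
     vector [poly (Ppoly w r (2 * m)) z,     Dfun w r (2 * m) z,     z^4 * Gfun w r (2 * m) z],
     vector [poly (Ppoly w r (2 * m - 1)) z, Dfun w r (2 * m - 1) z, z^2 * Gfun w r (2 * m - 1) z],
     vector [poly (Ppoly w r (2 * m - 2)) z, Dfun w r (2 * m - 2) z, Gfun w r (2 * m - 2) z]]
     = Yraw w r m z" (is "?V = _")
  proof -
    have 1: "Yraw w r m z $ 1 $ 3 = z ^ 4 * Gfun w r (2 * m) z"
      using G [of 1] by (simp add: row_degree_def)
    have 2: "Yraw w r m z $ 2 $ 3 = z ^ 2 * Gfun w r (2 * m - 1) z"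
    proof -
      have "2 * (2 * m - 1 + 2 - 2 * m) = 2" using m by simp
      then show ?thesis using G [of 2] by (simp add: row_degree_def)
    qed
    have 3: "Yraw w r m z $ 3 $ 3 = Gfun w r (2 * m - 2) z"
    proof -
      have "2 * (2 * m - 2 + 2 - 2 * m) = 0" using m by simp
      then show ?thesis using G [of 3] by (simp add: row_degree_def)
    qed
    have c: "Yraw w r m z $ i $ 1 = poly (Ppoly w r (row_degree m i)) z"
      "Yraw w r m z $ i $ 2 = Dfun w r (row_degree m i) z" for i
      by (simp_all add: Yraw_def Let_def Dfun)
    show ?thesis
      unfolding vec_eq_iff forall_3 by (simp add: vector_3 1 2 3 c, simp add: row_degree_def)
  qed
  then show ?thesis by (simp add: Yformula_def)
qed

lemma Yraw_holomorphic:
  assumes w: "continuous_on unit_circle w"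
  shows "(\<lambda>z. Yraw w r m z $ i $ j) holomorphic_on - unit_circle"
proof -
  have "even_cauchy (\<lambda>\<zeta>. \<zeta> powi k * weighted_Ppoly w r n \<zeta>) holomorphic_on - unit_circle" for k n
    by (intro even_cauchy_holomorphic continuous_intros continuous_on_weighted_Ppoly w)
  then show ?thesis
    using exhaust_3 [of j] by (auto simp: Yraw_def Let_def intro!: holomorphic_intros)
qed

text \<open>The first two columns are continuous across the circle. In the third, \<open>P (- z) = P z - 2 * z * q z\<close>, with \<open>q\<close> the
  odd quotient, rewrites the reflected half of the jump through the first two entries of the row.\<close>

lemma Yraw_boundary_values:
  assumes reg: "regular_symbol w" and m: "m \<ge> 1" and D: "\<And>i. Ddet w r (row_degree m i) \<noteq> 0"
  obtains Mp Mm where "has_boundary_values (Yraw w r m) Mp Mm"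
    and "\<And>z. z \<in> unit_circle \<Longrightarrow> Mp z = Mm z **
      vector [vector [1, 0, jump1 w r m z], vector [0, 1, jump2 w r m z], vector [0, 0, 1]]"
proof -
  note w = regular_symbol_continuous [OF reg]
  let ?f = "\<lambda>i. weighted_Ppoly w r (row_degree m i)"
  have "\<exists>Fp Fm. has_boundary_values (cauchy_transform (?f i)) Fp Fm \<and> (\<forall>z\<in>unit_circle. Fp z - Fm z = ?f i z)" for i
    using reg unfolding regular_symbol_def plemelj_sokhotskii_def weighted_Ppoly_def by blast
  then obtain Fp Fm where F: "\<And>i. has_boundary_values (cauchy_transform (?f i)) (Fp i) (Fm i)"
    and jump: "\<And>i z. z \<in> unit_circle \<Longrightarrow> Fp i z - Fm i z = ?f i z"
    by metis
  \<comment> \<open>\<open>T Fp\<close> and \<open>T Fm\<close> are the boundary values from the inside and from the outside.\<close>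
  define T where "T H z = (\<chi> i j. if j = 3 then z powi (4 - 4 * int m) * (H i z + H i (- z)) else Yraw w r m z $ i $ j)"
    for H :: "3 \<Rightarrow> complex \<Rightarrow> complex" and z
  have "has_boundary_values (Yraw w r m) (T Fp) (T Fm)"
  proof (rule has_boundary_values_matrix)
    fix i j :: 3
    show "has_boundary_values (\<lambda>z. Yraw w r m z $ i $ j) (\<lambda>z. T Fp z $ i $ j) (\<lambda>z. T Fm z $ i $ j)"
    proof (cases "j = 3")
      case True
      have "has_boundary_values (\<lambda>z. z powi (4 - 4 * int m) * (cauchy_transform (?f i) z + cauchy_transform (?f i) (- z)))
          (\<lambda>z. z powi (4 - 4 * int m) * (Fp i z + Fp i (- z))) (\<lambda>z. z powi (4 - 4 * int m) * (Fm i z + Fm i (- z)))"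
        by (intro has_boundary_values_mult has_boundary_values_add has_boundary_values_reflect F
            has_boundary_values_isCont) (auto intro!: continuous_intros)
      then have "has_boundary_values (\<lambda>z. Yraw w r m z $ i $ 3)
          (\<lambda>z. z powi (4 - 4 * int m) * (Fp i z + Fp i (- z))) (\<lambda>z. z powi (4 - 4 * int m) * (Fm i z + Fm i (- z)))"
      proof (rule has_boundary_values_cong)
        fix z assume "z \<in> - unit_circle - {0}"
        then have z: "norm z \<noteq> 1" "z \<noteq> 0" by auto
        show "z powi (4 - 4 * int m) * (cauchy_transform (?f i) z + cauchy_transform (?f i) (- z)) = Yraw w r m z $ i $ 3"
          unfolding Yraw_third_column [OF w m D z] cauchy_transform_even_part [OF continuous_on_weighted_Ppoly [OF w] z(1)]
          by simp
      qed
      then show ?thesis by (simp add: True T_def)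
    next
      case False
      have "has_boundary_values (\<lambda>z. Yraw w r m z $ i $ j) (\<lambda>z. Yraw w r m z $ i $ j) (\<lambda>z. Yraw w r m z $ i $ j)"
        using False exhaust_3 [of j]
        by (intro has_boundary_values_isCont) (auto simp: Yraw_def Let_def)
      with False show ?thesis by (simp add: T_def)
    qed
  qed
  moreover have "T Fp z = T Fm z **
      vector [vector [1, 0, jump1 w r m z], vector [0, 1, jump2 w r m z], vector [0, 0, 1]]"
    (is "_ = _ ** ?J") if z: "z \<in> unit_circle" for z
  proof -
    have z0: "z \<noteq> 0" "- z \<in> unit_circle" using z by auto
    have "T Fp z $ i $ j = (T Fm z ** ?J) $ i $ j" for i j
    proof (cases j rule: three_cases)
      case 3
      let ?p = "Ppoly w r (row_degree m i)"
      let ?e = "z powi (4 - 4 * int m)" and ?q = "poly (odd_quotient ?p) z"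
      let ?s = "(- 1 :: complex) powi r"
      have pm: "poly ?p (- z) = poly ?p z - 2 * z * ?q"
        using poly_odd_quotient [of z ?p] by (simp add: algebra_simps)
      have s: "(- 1 :: complex) powi (- r) = ?s"
        by (rule power_int_minus_one_minus)
      have "(- z) powi (- r) = ?s * z powi (- r)"
        using power_int_mult_distrib [of "- 1" z "- r"] s by simp
      then have "?f i z + ?f i (- z)
          = z powi (- r) * ((w z + ?s * w (- z)) * poly ?p z - 2 * ?s * z * w (- z) * ?q)"
        by (simp add: weighted_Ppoly_def pm algebra_simps)
      then have "?e * (?f i z + ?f i (- z))
          = (?e * z powi (- r)) * ((w z + ?s * w (- z)) * poly ?p z - 2 * ?s * z * w (- z) * ?q)"
        by (simp only: mult.assoc)
      also have "?e * z powi (- r) = z powi (- 4 * int m - r + 4)"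
        using z0 by (simp add: power_int_add [symmetric] algebra_simps)
      also have "\<dots> * ((w z + ?s * w (- z)) * poly ?p z - 2 * ?s * z * w (- z) * ?q)
          = poly ?p z * jump1 w r m z + ?q * jump2 w r m z"
      proof -
        have "z powi (- 4 * int m - r + 5) = z powi (- 4 * int m - r + 4) * z"
          using z0 power_int_add_1 [of z "- 4 * int m - r + 4"] by (simp add: algebra_simps)
        moreover have "(- 1 :: complex) powi (r + 1) = - ?s"
          by (simp add: power_int_add)
        ultimately show ?thesis
          unfolding jump1_def jump2_def by (simp only:) (simp only: algebra_simps, simp)
      qed
      finally have "?e * (?f i z + ?f i (- z)) = poly ?p z * jump1 w r m z + ?q * jump2 w r m z" .
      moreover have "Fp i z + Fp i (- z) = Fm i z + Fm i (- z) + (?f i z + ?f i (- z))"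
        using jump [OF z, of i] jump [OF z0(2), of i] by (simp add: algebra_simps)
      ultimately have "?e * (Fp i z + Fp i (- z))
          = poly ?p z * jump1 w r m z + ?q * jump2 w r m z + ?e * (Fm i z + Fm i (- z))"
        by (simp add: distrib_left)
      then show ?thesis
        by (simp add: 3 T_def matrix_matrix_mult_def sum_3 vector_3 Yraw_def Let_def)
    qed (simp_all add: T_def matrix_matrix_mult_def sum_3 vector_3)
    then show ?thesis by (simp add: vec_eq_iff)
  qed
  ultimately show thesis by (rule that)
qed

text \<open>The entries of \<open>Amat\<close> are the coefficients of the powers \<open>2 * m\<close> and \<open>2 * m - 1\<close> in the polynomial of the row; the
  constants zero and one in its definition are the cases decided by degree and monicity. In this
  form they match the leading coefficients at infinity uniformly in the row.\<close>

lemma Amat_entries: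
  assumes w: "continuous_on unit_circle w" and m: "m \<ge> 1" and D: "\<And>i. Ddet w r (row_degree m i) \<noteq> 0"
  defines "p \<equiv> \<lambda>i. Ppoly w r (row_degree m i)"
  shows "Amat w r m $ i $ 1 = coeff (p i) (2 * m)"
    "Amat w r m $ i $ 2 = coeff (p i) (2 * m - 1)"
    "Amat w r m $ i $ 3 = gcoeff w r (row_degree m i)"
    "coeff (p 3) (2 * m - 2) = 1"
    "degree (p i) \<le> 2 * m"
proof -
  have deg: "degree (p i) = row_degree m i" "coeff (p i) (row_degree m i) = 1" for i
    using Ppoly_is_monic_orthogonal [OF w D [of i]] by (auto simp: p_def is_monic_orthogonal_def)
  have z: "coeff (p i) k = 0" if "row_degree m i < k" for i k
    using that deg(1) by (simp add: coeff_eq_0)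
  show "Amat w r m $ i $ 1 = coeff (p i) (2 * m)"
    using deg(2) [of 1] z [of 2 "2 * m"] z [of 3 "2 * m"] m exhaust_3 [of i]
    by (auto simp: Amat_def vector_3 row_degree_def)
  show "Amat w r m $ i $ 2 = coeff (p i) (2 * m - 1)"
    using deg(2) [of 2] z [of 3 "2 * m - 1"] m exhaust_3 [of i]
    by (auto simp: Amat_def vector_3 row_degree_def pcoeff_def p_def)
  show "Amat w r m $ i $ 3 = gcoeff w r (row_degree m i)"
    using exhaust_3 [of i] by (auto simp: Amat_def vector_3 row_degree_def)
  show "coeff (p 3) (2 * m - 2) = 1" using deg(2) [of 3] by (simp add: row_degree_def)
  show "degree (p i) \<le> 2 * m" unfolding deg by (simp add: row_degree_def)
qed

text \<open>The exponents of the diagonal matrix that describes the behaviour at infinity.\<close>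

definition growth :: "nat \<Rightarrow> 3 \<Rightarrow> int" where
  "growth m j = (if j = 1 then 2 * int m else if j = 2 then 2 * int m - 2 else - 4 * int m + 2)"

text \<open>In the second column \<open>odd_quotient\<close> has only even powers, and in the third \<open>even_cauchy\<close> is even, so the
  \<open>1 / z\<close> terms come from the first column alone; they are the coefficients of \<open>z ^ (2 * m - 1)\<close>, that is, the second
  column of \<open>Amat\<close>.\<close>

lemma Yraw_expansion:
  assumes w: "continuous_on unit_circle w" and m: "m \<ge> 1" and D: "\<And>i. Ddet w r (row_degree m i) \<noteq> 0"
  obtains c where "c 3 1 = 1"
    "\<And>i j. expands2 (\<lambda>z. Yraw w r m z $ i $ j / z powi growth m j) (Amat w r m $ i $ j)
       (if j = 1 then Amat w r m $ i $ 2 else 0) (c i j)"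
proof -
  let ?p = "\<lambda>i. Ppoly w r (row_degree m i)"
  note A = Amat_entries [OF w m D]
  define c2 where "c2 i = (if 2 * m - 2 \<ge> 2 then coeff (odd_quotient (?p i)) (2 * m - 2 - 2) else 0)" for i
  have "\<exists>c. expands2 (\<lambda>z. Yraw w r m z $ i $ 3 / z powi growth m 3) (Amat w r m $ i $ 3) 0 c" for i
  proof -
    have "continuous_on unit_circle (weighted_Ppoly w r (row_degree m i))" by (rule continuous_on_weighted_Ppoly [OF w])
    from expands2_even_cauchy [OF this] obtain c where
      "expands2 (\<lambda>z. 2 * z\<^sup>2 * even_cauchy (weighted_Ppoly w r (row_degree m i)) z) (Amat w r m $ i $ 3) 0 c"
      unfolding A(3) gcoeff_first_moment [OF w D] by blast
    then have "expands2 (\<lambda>z. Yraw w r m z $ i $ 3 / z powi growth m 3) (Amat w r m $ i $ 3) 0 c"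
    proof (rule expands2_cong)
      have "2 * z\<^sup>2 * even_cauchy (weighted_Ppoly w r (row_degree m i)) z = Yraw w r m z $ i $ 3 / z powi growth m 3"
        if "norm z \<ge> 2" for z
      proof -
        have z: "norm z \<noteq> 1" "z \<noteq> 0" using that by auto
        have "z powi (4 - 4 * int m) = z powi growth m 3 * z\<^sup>2"
          using z power_int_add [of z "growth m 3" 2] by (simp add: growth_def)
        then show ?thesis
          using z by (simp add: Yraw_third_column [OF w m D z])
      qed
      then show "\<forall>\<^sub>F z in at_infinity. 2 * z\<^sup>2 * even_cauchy (weighted_Ppoly w r (row_degree m i)) z
          = Yraw w r m z $ i $ 3 / z powi growth m 3"
        unfolding eventually_at_infinity by blast
    qed
    then show ?thesis by blast
  qed
  then obtain c3 where c3: "\<And>i. expands2 (\<lambda>z. Yraw w r m z $ i $ 3 / z powi growth m 3) (Amat w r m $ i $ 3) 0 (c3 i)"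
    by metis
  have c1: "expands2 (\<lambda>z. Yraw w r m z $ i $ 1 / z powi growth m 1) (Amat w r m $ i $ 1)
      (Amat w r m $ i $ 2) (coeff (?p i) (2 * m - 2))" for i
  proof -
    have "growth m 1 = int (2 * m)" by (simp add: growth_def)
    then have "Yraw w r m z $ i $ 1 / z powi growth m 1 = poly (?p i) z / z ^ (2 * m)" for z
      by (simp only: power_int_of_nat) (simp add: Yraw_def Let_def)
    then show ?thesis
      using expands2_poly [OF A(5) [of i]] m by (simp add: A)
  qed
  have c2: "expands2 (\<lambda>z. Yraw w r m z $ i $ 2 / z powi growth m 2) (Amat w r m $ i $ 2) 0 (c2 i)" for i
  proof -
    have "growth m 2 = int (2 * m - 2)" using m by (simp add: growth_def)
    then have M: "Yraw w r m z $ i $ 2 / z powi growth m 2 = poly (odd_quotient (?p i)) z / z ^ (2 * m - 2)" for z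
      by (simp only: power_int_of_nat) (simp add: Yraw_def Let_def)
    have a: "coeff (odd_quotient (?p i)) (2 * m - 2) = Amat w r m $ i $ 2"
    proof -
      have "Suc (2 * m - 2) = 2 * m - 1" using m by simp
      then show ?thesis by (simp add: A coeff_odd_quotient)
    qed
    have b: "(if 2 * m - 2 \<ge> 1 then coeff (odd_quotient (?p i)) (2 * m - 2 - 1) else 0) = 0"
    proof -
      have "odd (2 * m - 2 - 1)" if "2 * m - 2 \<ge> 1" using that by presburger
      then show ?thesis by (simp add: coeff_odd_quotient)
    qed
    show ?thesis
      using expands2_poly [OF degree_odd_quotient_le [OF A(5) [of i]]]
      unfolding M a b c2_def .
  qed
  define c where "c i j = (if j = 1 then coeff (?p i) (2 * m - 2) else if j = 2 then c2 i else c3 i)" for i j :: 3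
  show thesis
  proof (rule that)
    show "c 3 1 = 1" by (simp add: c_def A(4))
    show "expands2 (\<lambda>z. Yraw w r m z $ i $ j / z powi growth m j) (Amat w r m $ i $ j)
       (if j = 1 then Amat w r m $ i $ 2 else 0) (c i j)" for i j
      by (cases j rule: three_cases) (simp_all add: c_def c1 c2 c3)
  qed
qed

section \<open>The normalised matrix and its Riemann-Hilbert problem\<close>

lemma invertible_Amat:
  assumes "gcoeff w r (2 * m - 2) \<noteq> 0"
  shows "invertible (Amat w r m)"
  unfolding invertible_det_nz det_3 using assms by (simp add: Amat_def vector_3)

text \<open>The origin is covered because \<open>Yraw\<close> is continuous there.\<close>

lemma Ymat_Yraw:
  assumes w: "continuous_on unit_circle w" and m: "m \<ge> 1" and D: "\<And>i. Ddet w r (row_degree m i) \<noteq> 0"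
  shows "(Yformula w r m \<longlongrightarrow> matrix_inv (Amat w r m) ** Yraw w r m 0) (at 0)"
    and "z \<in> - unit_circle \<Longrightarrow> Ymat w r m z = matrix_inv (Amat w r m) ** Yraw w r m z"
proof -
  have "isCont (\<lambda>z. Yraw w r m z $ i $ j) 0" for i j
    by (rule continuous_on_interior
        [OF holomorphic_on_imp_continuous_on [OF Yraw_holomorphic [OF w]]])
      (simp add: interior_open open_Compl)
  then have "((\<lambda>z. Yraw w r m z) \<longlongrightarrow> Yraw w r m 0) (at 0)"
    by (auto intro!: vec_tendstoI simp: isCont_def)
  then have "((\<lambda>z. matrix_inv (Amat w r m) ** Yraw w r m z) \<longlongrightarrow> matrix_inv (Amat w r m) ** Yraw w r m 0) (at 0)"
    by (rule tendsto_matrix_mult_left)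
  moreover have "\<forall>\<^sub>F z in at 0. matrix_inv (Amat w r m) ** Yraw w r m z = Yformula w r m z"
    unfolding eventually_at
    by (intro exI [of _ 1]) (auto simp: dist_norm Yformula_Yraw [OF w m D])
  ultimately show lim: "(Yformula w r m \<longlongrightarrow> matrix_inv (Amat w r m) ** Yraw w r m 0) (at 0)"
    by (rule Lim_transform_eventually)
  show "Ymat w r m z = matrix_inv (Amat w r m) ** Yraw w r m z" if "z \<in> - unit_circle"
  proof (cases "z = 0")
    case True
    have "Lim (at 0) (Yformula w r m) = matrix_inv (Amat w r m) ** Yraw w r m 0"
      by (rule tendsto_Lim [OF _ lim]) simp
    with True show ?thesis by (simp add: Ymat_def)
  next
    case False
    with that show ?thesis by (simp add: Ymat_def Yformula_Yraw [OF w m D])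
  qed
qed

theorem theorem3:
  fixes w :: "complex \<Rightarrow> complex" and m :: nat and r :: int
  assumes "m \<ge> 1"
    and "regular_symbol w"
    and "\<And>n. n \<in> {2 * m, 2 * m - 1, 2 * m - 2} \<Longrightarrow> Ddet w r n \<noteq> 0"
    and "Ddet w (r - 2) (2 * m - 1) \<noteq> 0"
  shows
    "\<comment> \<open>well-definedness\<close>
     (\<forall>n \<in> {2 * m, 2 * m - 1, 2 * m - 2}. \<exists>!p. is_monic_orthogonal w r n p) \<and>
     invertible (Amat w r m) \<and>
     (\<exists>L. (Yformula w r m \<longlongrightarrow> L) (at 0)) \<and>
     \<comment> \<open>(Y1)\<close>
     (\<forall>i j. (\<lambda>z. Ymat w r m z $ i $ j) holomorphic_on (- unit_circle)) \<and>
     \<comment> \<open>(Y2)\<close>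
     (\<exists>Yp Ym. has_boundary_values (Ymat w r m) Yp Ym \<and>
        (\<forall>z\<in>unit_circle. Yp z = Ym z **
           vector [vector [1, 0, jump1 w r m z],
                   vector [0, 1, jump2 w r m z],
                   vector [0, 0, 1]])) \<and>
     \<comment> \<open>(Y3)\<close>
     (\<exists>(Y1 :: complex^3^3) (Y2 :: complex^3^3) (E :: complex \<Rightarrow> complex^3^3).
        Y1 = vector [vector [0, 0, 0], vector [1, 0, 0], vector [0, 0, 0]] \<and>
        Y2 $ 3 $ 1 \<noteq> 0 \<and>
        (\<forall>i j. (\<lambda>z. E z $ i $ j) \<in> O[at_infinity](\<lambda>z. z powi (- 3))) \<and>
        (\<forall>\<^sub>F z in at_infinity. Ymat w r m z =
           (mat 1 + map_matrix (\<lambda>y. y / z) Y1 + map_matrix (\<lambda>y. y / z^2) Y2 + E z) **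
           vector [vector [z powi (2 * int m), 0, 0],
                   vector [0, z powi (2 * int m - 2), 0],
                   vector [0, 0, z powi (- 4 * int m + 2)]]))"
proof -
  note m = assms(1)
  note w = regular_symbol_continuous [OF assms(2)]
  have D: "Ddet w r (row_degree m i) \<noteq> 0" for i
    by (rule assms(3)) (simp add: row_degree_def)
  have "2 * m - 2 + 1 = 2 * m - 1" using m by simp
  then have g: "gcoeff w r (2 * m - 2) \<noteq> 0"
    using assms(3) [of "2 * m - 2"] assms(4) by (simp add: gcoeff_def)
  define A where "A = Amat w r m"
  have inv: "invertible A" unfolding A_def by (rule invertible_Amat [OF g])
  note Y = Ymat_Yraw [OF w m D, folded A_def]
  have hol: "(\<lambda>z. Ymat w r m z $ i $ j) holomorphic_on - unit_circle" for i j
  proof (rule holomorphic_transform)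
    show "(\<lambda>z. (matrix_inv A ** Yraw w r m z) $ i $ j) holomorphic_on - unit_circle"
      unfolding matrix_matrix_mult_def
      by (simp, intro holomorphic_intros Yraw_holomorphic [OF w])
  qed (simp add: Y(2))
  have boundary: "\<exists>Yp Ym. has_boundary_values (Ymat w r m) Yp Ym \<and>
        (\<forall>z\<in>unit_circle. Yp z = Ym z **
           vector [vector [1, 0, jump1 w r m z],
                   vector [0, 1, jump2 w r m z],
                   vector [0, 0, 1]])"
  proof -
    obtain Mp Mm where M: "has_boundary_values (Yraw w r m) Mp Mm"
      "\<And>z. z \<in> unit_circle \<Longrightarrow> Mp z = Mm z **
        vector [vector [1, 0, jump1 w r m z], vector [0, 1, jump2 w r m z], vector [0, 0, 1]]"
      using Yraw_boundary_values [OF assms(2) m D] by blast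
    have "has_boundary_values (Ymat w r m) (\<lambda>z. matrix_inv A ** Mp z) (\<lambda>z. matrix_inv A ** Mm z)"
      by (rule has_boundary_values_cong [OF has_boundary_values_matrix_mult_left [OF M(1)]])
        (simp add: Y(2))
    then show ?thesis
      by (intro exI [of _ "\<lambda>z. matrix_inv A ** Mp z"] exI [of _ "\<lambda>z. matrix_inv A ** Mm z"] conjI ballI)
        (simp_all add: M(2) matrix_mul_assoc)
  qed
  have infinity: "\<exists>(Y1 :: complex^3^3) (Y2 :: complex^3^3) (E :: complex \<Rightarrow> complex^3^3).
        Y1 = vector [vector [0, 0, 0], vector [1, 0, 0], vector [0, 0, 0]] \<and>
        Y2 $ 3 $ 1 \<noteq> 0 \<and>
        (\<forall>i j. (\<lambda>z. E z $ i $ j) \<in> O[at_infinity](\<lambda>z. z powi (- 3))) \<and>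
        (\<forall>\<^sub>F z in at_infinity. Ymat w r m z =
           (mat 1 + map_matrix (\<lambda>y. y / z) Y1 + map_matrix (\<lambda>y. y / z^2) Y2 + E z) **
           vector [vector [z powi (2 * int m), 0, 0],
                   vector [0, z powi (2 * int m - 2), 0],
                   vector [0, 0, z powi (- 4 * int m + 2)]])"
  proof -
    obtain c where c: "c 3 1 = 1" "\<And>i j. expands2 (\<lambda>z. Yraw w r m z $ i $ j / z powi growth m j) (A $ i $ j)
       (if j = 1 then A $ i $ 2 else 0) (c i j)"
      unfolding A_def using Yraw_expansion [OF w m D] by blast
    define N where "N z = (\<chi> i j. Yraw w r m z $ i $ j / z powi growth m j)" for z
    define Y1 :: "complex^3^3" where "Y1 = vector [vector [0, 0, 0], vector [1, 0, 0], vector [0, 0, 0]]"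
    define B2 :: "complex^3^3" where "B2 = (\<chi> i j. c i j)"
    have AY1: "(A ** Y1) $ i $ j = (if j = 1 then A $ i $ 2 else 0)" for i j
      using exhaust_3 [of j] by (auto simp: Y1_def matrix_matrix_mult_def sum_3 vector_3)
    have "expands2 (\<lambda>z. N z $ i $ j) (A $ i $ j) ((A ** Y1) $ i $ j) (B2 $ i $ j)" for i j
      unfolding AY1 using c(2) [of i j] by (simp add: N_def B2_def)
    then obtain E :: "complex \<Rightarrow> complex^3^3" where E: "\<And>i j. (\<lambda>z. E z $ i $ j) \<in> O[at_infinity](\<lambda>z. z powi (- 3))"
      "\<And>z. matrix_inv A ** N z = mat 1 + map_matrix (\<lambda>y. y / z) (matrix_inv A ** (A ** Y1))
        + map_matrix (\<lambda>y. y / z\<^sup>2) (matrix_inv A ** B2) + E z"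
      using normalised_expansion [OF inv] by blast
    have Y1: "matrix_inv A ** (A ** Y1) = Y1"
      by (simp add: matrix_mul_assoc matrix_inv_mult(2) [OF inv])
    have "(matrix_inv A ** B2) $ 3 $ 1 \<noteq> 0"
    proof
      \<comment> \<open>The last row of \<open>A\<close> has a single nonzero entry, so \<open>A\<close> would map this zero to the entry \<open>1\<close> of \<open>B2\<close>.\<close>
      assume 0: "(matrix_inv A ** B2) $ 3 $ 1 = 0"
      have "(A ** (matrix_inv A ** B2)) $ 3 $ 1 = B2 $ 3 $ 1"
        by (simp add: matrix_mul_assoc matrix_inv_mult(1) [OF inv])
      moreover have "A $ 3 $ 1 = 0" "A $ 3 $ 2 = 0" by (simp_all add: A_def Amat_def vector_3)
      ultimately show False
        using 0 c(1) unfolding matrix_matrix_mult_def [of A] by (simp add: sum_3 B2_def)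
    qed
    moreover have "Ymat w r m z = (mat 1 + map_matrix (\<lambda>y. y / z) Y1 + map_matrix (\<lambda>y. y / z^2) (matrix_inv A ** B2) + E z) **
           vector [vector [z powi (2 * int m), 0, 0],
                   vector [0, z powi (2 * int m - 2), 0],
                   vector [0, 0, z powi (- 4 * int m + 2)]]" (is "_ = _ ** ?S") if "norm z \<ge> 2" for z
    proof -
      have z: "z \<in> - unit_circle" "z \<noteq> 0" using that by auto
      have "Yraw w r m z = N z ** ?S"
        using z by (simp add: vec_eq_iff forall_3 matrix_matrix_mult_def sum_3 vector_3 N_def growth_def)
      then have "Ymat w r m z = matrix_inv A ** N z ** ?S"
        using Y(2) [OF z(1)] by (simp add: matrix_mul_assoc)
      then show ?thesis unfolding E(2) Y1 .
    qed
    ultimately show ?thesis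
      using E(1) Y1_def unfolding eventually_at_infinity
      by (intro exI [of _ Y1] exI [of _ "matrix_inv A ** B2"] exI [of _ E] exI [of _ 2] conjI allI impI)
  qed
  show ?thesis
  proof (intro conjI)
    show "\<forall>n \<in> {2 * m, 2 * m - 1, 2 * m - 2}. \<exists>!p. is_monic_orthogonal w r n p"
      using is_monic_orthogonal_ex1 [OF w assms(3)] by blast
    show "invertible (Amat w r m)" using inv by (simp only: A_def)
    show "\<exists>L. (Yformula w r m \<longlongrightarrow> L) (at 0)" using Y(1) by (rule exI)
    show "\<forall>i j. (\<lambda>z. Ymat w r m z $ i $ j) holomorphic_on - unit_circle" using hol by (intro allI)
  qed (fact boundary infinity)+
qed

end
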